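(* Let $n$ be a positive integer and let $\mathcal{P}$ be a subset of the family of convex absolutely homogeneous functions from $\mathbb{R}^n$ to $\mathbb{R}_+$. Assume that for every convex absolutely homogeneous function $V:\mathbb{R}^n\to\mathbb{R}_+$ and every $\delta>0$ there exists a function $W\in\mathcal{P}$ such that $|W(x)-V(x)|\leq \delta$ for every $x$ in the unit sphere $S^{n-1}$ of $\mathbb{R}^n$. Then $\mathcal{P}$ is a universal class of Lyapunov functions.
   Context: Notation: $\mathbb{R}_+=[0,+\infty)$; $M_n(\mathbb{R})$ is the set of real $n\times n$ matrices. A function $V:\mathbb{R}^n\to\mathbb{R}$ is absolutely homogeneous (of degree 1) if $V(\lambda x)=|\lambda|V(x)$ for every $x\in\mathbb{R}^n$ and $\lambda\in\mathbb{R}$. Linear switched systems: for a bounded set $\mathscr{M}\subset M_n(\mathbb{R})$, the linear switched system $(\Sigma_{\mathscr{M}})$ is $\dot x(t)=A(t)x(t)$, $t\ge 0$, $x\in\mathbb{R}^n$, where the switching law $A$ is an arbitrary element of $L^\infty(\mathbb{R}_+,\mathscr{M})$, the space of measurable functions from $\mathbb{R}_+$ to $\mathscr{M}$. For a switching law $A$, $\Phi_A(t,s)$ denotes the fundamental matrix from $s$ to $t$, so that every solution (trajectory) satisfies $x(t)=\Phi_A(t,0)x(0)$. Stability: $(\Sigma_{\mathscr{M}})$ is uniformly exponentially stable if there exist $C,\gamma>0$ such that $\|\Phi_A(t,0)\|\le Ce^{-\gamma t}$ for every switching law $A$ and every $t\ge 0$. Common Lyapunov function: a continuous function $V:\mathbb{R}^n\to\mathbb{R}_+$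 is a common Lyapunov function for $(\Sigma_{\mathscr{M}})$ if it is positive definite (i.e. $V(0)=0$ and $V(x)>0$ for $x\ne 0$) and $V$ is strictly decreasing along each nonzero trajectory of $(\Sigma_{\mathscr{M}})$ (i.e. $t\mapsto V(x(t))$ is strictly decreasing on $\mathbb{R}_+$ for every trajectory $x(\cdot)$ with $x(0)\neq 0$). Universality: a set $\mathcal{P}$ of functions from $\mathbb{R}^n$ to $\mathbb{R}$ is a universal class of Lyapunov functions if for every bounded set $\mathscr{M}\subset M_n(\mathbb{R})$ such that $(\Sigma_{\mathscr{M}})$ is uniformly exponentially stable there exists a common Lyapunov function for $(\Sigma_{\mathscr{M}})$ in $\mathcal{P}$. *)

theory Defs
  imports "HOL-Analysis.Analysis"
begin

section \<open>Linear switched systems\<close>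

text \<open>
  Vectors are \<^typ>\<open>real^'n\<close>, so that the dimension is \<^term>\<open>CARD('n)\<close>, which is positive for every
  finite index type. Matrices carry the norm of \<^typ>\<open>real^'n^'n\<close> (the Frobenius norm); all norms on
  matrices are equivalent, so neither boundedness nor exponential stability depends on this choice.
\<close>

definition switching_laws :: "(real^'n^'n) set \<Rightarrow> (real \<Rightarrow> real^'n^'n) set" where
  "switching_laws M = {A. A \<in> borel_measurable (lebesgue_on {0..}) \<and> (\<forall>t\<ge>0. A t \<in> M)}"

text \<open>
  Absolute continuity on a compact interval; the elements of a division are nonempty compact
  intervals with disjoint interiors, and \<^term>\<open>Inf K\<close>, \<^term>\<open>Sup K\<close> are the endpoints of \<^term>\<open>K\<close>.
\<close>

definition abs_continuous_on :: "real set \<Rightarrow> (real \<Rightarrow> 'a::metric_space) \<Rightarrow> bool" where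
  "abs_continuous_on S f \<longleftrightarrow>
     (\<forall>\<epsilon>>0. \<exists>\<delta>>0. \<forall>\<D>. \<D> division_of (\<Union>\<D>) \<and> \<Union>\<D> \<subseteq> S \<and> (\<Sum>K\<in>\<D>. Sup K - Inf K) < \<delta> \<longrightarrow>
        (\<Sum>K\<in>\<D>. dist (f (Inf K)) (f (Sup K))) < \<epsilon>)"

text \<open>
  The right-hand side of the system is only measurable in time, so a solution of
  \<open>x'(t) = F t (x t)\<close> for \<open>t \<ge> s\<close> is understood in the sense of Caratheodory: locally
  absolutely continuous, and satisfying the equation for almost every time.
\<close>

definition solution_from ::
    "real \<Rightarrow> (real \<Rightarrow> 'a \<Rightarrow> 'a) \<Rightarrow> (real \<Rightarrow> 'a::real_normed_vector) \<Rightarrow> bool" where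
  "solution_from s F x \<longleftrightarrow>
     (\<forall>T\<ge>s. abs_continuous_on {s..T} x) \<and>
     (AE t in lebesgue_on {s..}. (x has_vector_derivative F t (x t)) (at t within {s..}))"

definition trajectory :: "(real \<Rightarrow> real^'n^'n) \<Rightarrow> (real \<Rightarrow> real^'n) \<Rightarrow> bool" where
  "trajectory A x \<longleftrightarrow> solution_from 0 (\<lambda>t y. A t *v y) x"

text \<open>
  \<open>fundamental_matrix A t s\<close>, for \<open>t \<ge> s\<close>, is the value at \<open>t\<close> of the solution of the matrix
  equation \<open>Y' = A Y\<close>, \<open>Y s = 1\<close>. The description ranges over the value at \<open>t\<close> since \<open>Y\<close>
  itself is unique only on \<open>{s..}\<close>.
\<close>

definition fundamental_matrix :: "(real \<Rightarrow> real^'n^'n) \<Rightarrow> real \<Rightarrow> real \<Rightarrow> real^'n^'n" where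
  "fundamental_matrix A t s =
     (THE X. \<exists>Y. solution_from s (\<lambda>r Z. A r ** Z) Y \<and> Y s = mat 1 \<and> X = Y t)"

definition uniformly_exponentially_stable :: "(real^'n^'n) set \<Rightarrow> bool" where
  "uniformly_exponentially_stable M \<longleftrightarrow>
     (\<exists>C>0. \<exists>\<gamma>>0. \<forall>A\<in>switching_laws M. \<forall>t\<ge>0.
        norm (fundamental_matrix A t 0) \<le> C * exp (- \<gamma> * t))"


section \<open>Common Lyapunov functions and universal classes\<close>

definition common_lyapunov_function :: "(real^'n^'n) set \<Rightarrow> (real^'n \<Rightarrow> real) \<Rightarrow> bool" where
  "common_lyapunov_function M V \<longleftrightarrow>
     continuous_on UNIV V \<and> (\<forall>x. 0 \<le> V x) \<and>
     V 0 = 0 \<and> (\<forall>x. x \<noteq> 0 \<longrightarrow> 0 < V x) \<and>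
     (\<forall>A\<in>switching_laws M. \<forall>x. trajectory A x \<and> x 0 \<noteq> 0 \<longrightarrow>
        strict_antimono_on {0..} (\<lambda>t. V (x t)))"

definition universal_lyapunov_class :: "(real^'n \<Rightarrow> real) set \<Rightarrow> bool" where
  "universal_lyapunov_class P \<longleftrightarrow>
     (\<forall>M. bounded M \<and> uniformly_exponentially_stable M \<longrightarrow>
        (\<exists>V\<in>P. common_lyapunov_function M V))"

definition absolutely_homogeneous :: "(real^'n \<Rightarrow> real) \<Rightarrow> bool" where
  "absolutely_homogeneous V \<longleftrightarrow> (\<forall>x c. V (c *\<^sub>R x) = \<bar>c\<bar> * V x)"

definition convex_abs_homogeneous :: "(real^'n \<Rightarrow> real) set" where
  "convex_abs_homogeneous =
     {V. convex_on UNIV V \<and> absolutely_homogeneous V \<and> (\<forall>x. 0 \<le> V x)}"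

end

theory Submission
  imports Defs
begin

text \<open>
  For a uniformly exponentially stable system with rate \<open>\<gamma>\<close>, the supremum \<open>V x\<close> of
  \<open>e\<^sup>\<gamma>\<^sup>t \<bar>\<Phi>\<^sub>A(t,0) x\<bar>\<close> over \<open>t \<ge> 0\<close> and laws \<open>A\<close> with a piecewise differentiable flow is a norm with
  \<open>V (e\<^sup>h\<^sup>A x) \<le> e\<^sup>-\<^sup>\<gamma>\<^sup>h V x\<close> for \<open>A \<in> M\<close>. Replacing \<open>e\<^sup>h\<^sup>A x\<close> by the Euler step \<open>x + h A x\<close> costs only
  \<open>O(h\<^sup>2)\<close>, so for one fixed small \<open>h\<close> we get \<open>V (x + h A x) \<le> V x - c \<bar>x\<bar>\<close> uniformly in \<open>A\<close>. As \<open>h\<close> is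
  fixed, this inequality survives uniform approximation of \<open>V\<close> on the sphere, with a smaller \<open>c\<close>.
  For the convex approximant \<open>W\<close> it then bounds the slope of \<open>W\<close> at \<open>x\<close> in the direction \<open>A x\<close>,
  so \<open>W\<close> has a strictly negative derivative along trajectories almost everywhere, and absolute
  continuity turns this into strict decrease.
\<close>

section \<open>Absolutely continuous functions\<close>

text \<open>Distinct tagged pairs have intervals with disjoint interiors, so a repeated interval is
  a single point, where \<open>h\<close> vanishes. This passes from the tagged divisions of Cousin's
  lemma to the untagged ones in \<open>abs_continuous_on\<close>.\<close>

lemma sum_tagged_partial_division:
  fixes h :: "real set \<Rightarrow> real"
  assumes p: "p tagged_partial_division_of S"
    and h: "\<And>u. h {u..u} = 0"
  shows "(\<Sum>(x, K)\<in>p. h K) = (\<Sum>K\<in>snd ` p. h K)"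
proof -
  \<comment> \<open>\<open>sum.over_tagged_division_lemma\<close> also asks for the value 0 at the
    empty interval, on which \<open>h\<close> is unconstrained; no pair of \<open>p\<close> carries
    it.\<close>
  define h' where "h' K = (if K = {} then 0 else h K)" for K
  have ne: "K \<noteq> {}" if "(x, K) \<in> p" for x K
    using tagged_partial_division_ofD(2)[OF p that] by auto
  have "(\<Sum>(x, K)\<in>p. h K) = (\<Sum>(x, K)\<in>p. h' K)"
    using ne by (intro sum.cong) (auto simp: h'_def)
  also have "\<dots> = (\<Sum>K\<in>snd ` p. h' K)"
  proof (rule sum.over_tagged_division_lemma[OF tagged_partial_division_of_Union_self[OF p]])
    fix u v :: real
    assume "box u v = {}"
    then have "u = v \<or> cbox u v = {}" by auto
    then show "h' (cbox u v) = 0" using h by (auto simp: h'_def)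
  qed
  also have "\<dots> = (\<Sum>K\<in>snd ` p. h K)"
    using ne by (intro sum.cong) (auto simp: h'_def)
  finally show ?thesis .
qed

lemma division_of_Sup_diff_Inf:
  fixes \<D> :: "real set set"
  assumes "\<D> division_of S"
  shows "(\<Sum>K\<in>\<D>. Sup K - Inf K) = measure lebesgue S"
proof -
  have "(\<Sum>K\<in>\<D>. Sup K - Inf K) = (\<Sum>K\<in>\<D>. measure lebesgue K)"
  proof (rule sum.cong[OF refl])
    fix K assume K: "K \<in> \<D>"
    then obtain u v where "K = cbox u v" "K \<noteq> {}"
      using division_ofD[OF assms] by blast
    then show "Sup K - Inf K = measure lebesgue K" by auto
  qed
  then show ?thesis using content_division[OF assms] by simp
qed

lemma abs_continuous_onD:
  assumes "abs_continuous_on S f" "\<epsilon> > 0"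
  obtains \<delta> where "\<delta> > 0"
    "\<And>\<D>. \<D> division_of \<Union>\<D> \<Longrightarrow> \<Union>\<D> \<subseteq> S \<Longrightarrow> (\<Sum>K\<in>\<D>. Sup K - Inf K) < \<delta>
      \<Longrightarrow> (\<Sum>K\<in>\<D>. dist (f (Inf K)) (f (Sup K))) < \<epsilon>"
  using assms unfolding abs_continuous_on_def by metis

lemma division_Inf_Sup_mem:
  fixes \<D> :: "real set set"
  assumes "\<D> division_of \<Union>\<D>" "K \<in> \<D>"
  shows "Inf K \<in> \<Union>\<D>" "Sup K \<in> \<Union>\<D>" "Inf K \<le> Sup K" "K = {Inf K..Sup K}"
proof -
  obtain u v where K: "K = cbox u v" "K \<noteq> {}"
    using division_ofD[OF assms(1)] assms(2) by blast
  then have "u \<le> v" "Inf K = u" "Sup K = v" by auto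
  then show "Inf K \<in> \<Union>\<D>" "Sup K \<in> \<Union>\<D>" "Inf K \<le> Sup K" "K = {Inf K..Sup K}"
    using K assms(2) by (auto intro!: bexI[of _ K])
qed

text \<open>One transfer principle with several uses: \<open>L = 0\<close> gives Lipschitz
  functions, \<open>M = 0\<close> gives Lipschitz images of \<open>f\<close>, and
  \<open>L = 1\<close> allows the subtraction of a linear term.\<close>

lemma abs_continuous_on_dominated:
  fixes g :: "real \<Rightarrow> 'b::metric_space" and f :: "real \<Rightarrow> 'a::metric_space"
  assumes f: "abs_continuous_on S f" and "L \<ge> 0" "M \<ge> 0"
    and le: "\<And>u v. u \<in> S \<Longrightarrow> v \<in> S \<Longrightarrow> dist (g u) (g v) \<le> L * dist (f u) (f v) + M * \<bar>v - u\<bar>"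
  shows "abs_continuous_on S g"
  unfolding abs_continuous_on_def
proof (intro allI impI)
  fix \<epsilon> :: real assume "\<epsilon> > 0"
  then have "\<epsilon> / (2 * (L + 1)) > 0" using \<open>L \<ge> 0\<close> by simp
  with f obtain \<delta> where \<delta>: "\<delta> > 0" and f\<delta>:
    "\<And>\<D>. \<D> division_of \<Union>\<D> \<Longrightarrow> \<Union>\<D> \<subseteq> S \<Longrightarrow> (\<Sum>K\<in>\<D>. Sup K - Inf K) < \<delta>
      \<Longrightarrow> (\<Sum>K\<in>\<D>. dist (f (Inf K)) (f (Sup K))) < \<epsilon> / (2 * (L + 1))"
    by (rule abs_continuous_onD) blast
  \<comment> \<open>Increments of \<open>f\<close> and lengths of intervals each contribute less
    than \<open>\<epsilon> / 2\<close>; the added 1 covers \<open>L = 0\<close> and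
    \<open>M = 0\<close>.\<close>
  define \<eta> where "\<eta> = min \<delta> (\<epsilon> / (2 * (M + 1)))"
  have "\<eta> > 0" using \<delta> \<open>\<epsilon> > 0\<close> \<open>M \<ge> 0\<close> by (simp add: \<eta>_def)
  moreover have "(\<Sum>K\<in>\<D>. dist (g (Inf K)) (g (Sup K))) < \<epsilon>"
    if D: "\<D> division_of \<Union>\<D>" "\<Union>\<D> \<subseteq> S" "(\<Sum>K\<in>\<D>. Sup K - Inf K) < \<eta>" for \<D>
  proof -
    let ?F = "\<Sum>K\<in>\<D>. dist (f (Inf K)) (f (Sup K))" and ?T = "\<Sum>K\<in>\<D>. Sup K - Inf K"
    have "(\<Sum>K\<in>\<D>. dist (g (Inf K)) (g (Sup K)))
        \<le> (\<Sum>K\<in>\<D>. L * dist (f (Inf K)) (f (Sup K)) + M * (Sup K - Inf K))"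
    proof (rule sum_mono)
      fix K assume "K \<in> \<D>"
      note K = division_Inf_Sup_mem(1-3)[OF D(1) this]
      show "dist (g (Inf K)) (g (Sup K)) \<le> L * dist (f (Inf K)) (f (Sup K)) + M * (Sup K - Inf K)"
        using le[of "Inf K" "Sup K"] K D(2) by auto
    qed
    also have "\<dots> = L * ?F + M * ?T"
      by (simp add: sum.distrib sum_distrib_left)
    also have "\<dots> < \<epsilon>"
    proof -
      have F: "?F < \<epsilon> / (2 * (L + 1))" using f\<delta> D by (simp add: \<eta>_def)
      have T: "?T < \<epsilon> / (2 * (M + 1))" using D by (simp add: \<eta>_def)
      have "L * ?F \<le> L * (\<epsilon> / (2 * (L + 1)))" using F \<open>L \<ge> 0\<close> by (intro mult_left_mono) auto
      also have "\<dots> < \<epsilon> / 2" using \<open>L \<ge> 0\<close> \<open>\<epsilon> > 0\<close> by (simp add: field_simps)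
      finally have 1: "L * ?F < \<epsilon> / 2" .
      have "M * ?T \<le> M * (\<epsilon> / (2 * (M + 1)))" using T \<open>M \<ge> 0\<close> by (intro mult_left_mono) auto
      also have "\<dots> < \<epsilon> / 2" using \<open>M \<ge> 0\<close> \<open>\<epsilon> > 0\<close> by (simp add: field_simps)
      finally show ?thesis using 1 by simp
    qed
    finally show ?thesis .
  qed
  ultimately show "\<exists>\<delta>>0. \<forall>\<D>. \<D> division_of \<Union>\<D> \<and> \<Union>\<D> \<subseteq> S \<and> (\<Sum>K\<in>\<D>. Sup K - Inf K) < \<delta>
      \<longrightarrow> (\<Sum>K\<in>\<D>. dist (g (Inf K)) (g (Sup K))) < \<epsilon>" by blast
qed

lemma abs_continuous_on_const: "abs_continuous_on S (\<lambda>_. c)"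
  unfolding abs_continuous_on_def by (auto intro: exI[of _ 1])

lemma lipschitz_imp_abs_continuous_on:
  fixes g :: "real \<Rightarrow> 'b::metric_space"
  assumes "B \<ge> 0" "\<And>u v. u \<in> S \<Longrightarrow> v \<in> S \<Longrightarrow> dist (g u) (g v) \<le> B * \<bar>v - u\<bar>"
  shows "abs_continuous_on S g"
  by (rule abs_continuous_on_dominated[OF abs_continuous_on_const[of S 0], of 0 B]) (use assms in auto)

lemma abs_continuous_on_subset:
  assumes "abs_continuous_on S f" "T \<subseteq> S"
  shows "abs_continuous_on T f"
  using assms unfolding abs_continuous_on_def by (meson subset_trans)

lemma abs_continuous_on_diff:
  fixes f g :: "real \<Rightarrow> 'a::real_normed_vector"
  assumes f: "abs_continuous_on S f" and g: "abs_continuous_on S g"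
  shows "abs_continuous_on S (\<lambda>t. f t - g t)"
  unfolding abs_continuous_on_def
proof (intro allI impI)
  fix \<epsilon> :: real assume "\<epsilon> > 0"
  then have e: "\<epsilon> / 2 > 0" by simp
  from f e obtain \<delta> where \<delta>: "\<delta> > 0" and f\<delta>:
    "\<And>\<D>. \<D> division_of \<Union>\<D> \<Longrightarrow> \<Union>\<D> \<subseteq> S \<Longrightarrow> (\<Sum>K\<in>\<D>. Sup K - Inf K) < \<delta>
      \<Longrightarrow> (\<Sum>K\<in>\<D>. dist (f (Inf K)) (f (Sup K))) < \<epsilon> / 2"
    by (rule abs_continuous_onD) blast
  from g e obtain \<delta>' where \<delta>': "\<delta>' > 0" and g\<delta>:
    "\<And>\<D>. \<D> division_of \<Union>\<D> \<Longrightarrow> \<Union>\<D> \<subseteq> S \<Longrightarrow> (\<Sum>K\<in>\<D>. Sup K - Inf K) < \<delta>'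
      \<Longrightarrow> (\<Sum>K\<in>\<D>. dist (g (Inf K)) (g (Sup K))) < \<epsilon> / 2"
    by (rule abs_continuous_onD) blast
  have "(\<Sum>K\<in>\<D>. dist (f (Inf K) - g (Inf K)) (f (Sup K) - g (Sup K))) < \<epsilon>"
    if D: "\<D> division_of \<Union>\<D>" "\<Union>\<D> \<subseteq> S" "(\<Sum>K\<in>\<D>. Sup K - Inf K) < min \<delta> \<delta>'" for \<D>
  proof -
    have "(\<Sum>K\<in>\<D>. dist (f (Inf K) - g (Inf K)) (f (Sup K) - g (Sup K)))
        \<le> (\<Sum>K\<in>\<D>. dist (f (Inf K)) (f (Sup K)) + dist (g (Inf K)) (g (Sup K)))"
    proof (rule sum_mono)
      fix K
      show "dist (f (Inf K) - g (Inf K)) (f (Sup K) - g (Sup K))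
          \<le> dist (f (Inf K)) (f (Sup K)) + dist (g (Inf K)) (g (Sup K))"
        using norm_triangle_ineq4[of "f (Inf K) - f (Sup K)" "g (Inf K) - g (Sup K)"]
        by (simp add: dist_norm algebra_simps)
    qed
    also have "\<dots> < \<epsilon>" using f\<delta>[of \<D>] g\<delta>[of \<D>] D by (simp add: sum.distrib)
    finally show ?thesis .
  qed
  then show "\<exists>\<delta>>0. \<forall>\<D>. \<D> division_of \<Union>\<D> \<and> \<Union>\<D> \<subseteq> S \<and> (\<Sum>K\<in>\<D>. Sup K - Inf K) < \<delta>
      \<longrightarrow> (\<Sum>K\<in>\<D>. dist (f (Inf K) - g (Inf K)) (f (Sup K) - g (Sup K))) < \<epsilon>"
    using \<delta> \<delta>' by (intro exI[of _ "min \<delta> \<delta>'"]) auto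
qed

text \<open>Continuity is the case of a division into a single interval.\<close>

lemma abs_continuous_on_imp_continuous_on:
  fixes f :: "real \<Rightarrow> 'a::metric_space"
  assumes "abs_continuous_on {a..b} f"
  shows "continuous_on {a..b} f"
  unfolding continuous_on_iff
proof (intro ballI allI impI)
  fix t \<epsilon> :: real assume t: "t \<in> {a..b}" and "\<epsilon> > 0"
  from assms \<open>\<epsilon> > 0\<close> obtain \<delta> where \<delta>: "\<delta> > 0" and f\<delta>:
    "\<And>\<D>. \<D> division_of \<Union>\<D> \<Longrightarrow> \<Union>\<D> \<subseteq> {a..b} \<Longrightarrow> (\<Sum>K\<in>\<D>. Sup K - Inf K) < \<delta>
      \<Longrightarrow> (\<Sum>K\<in>\<D>. dist (f (Inf K)) (f (Sup K))) < \<epsilon>"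
    by (rule abs_continuous_onD) blast
  have *: "dist (f u) (f v) < \<epsilon>" if "u \<in> {a..b}" "v \<in> {a..b}" "u \<le> v" "v - u < \<delta>" for u v
  proof -
    have "{cbox u v} division_of \<Union>{cbox u v}"
      using that division_of_self[of u v] by auto
    then show ?thesis using f\<delta>[of "{cbox u v}"] that by auto
  qed
  show "\<exists>d>0. \<forall>s\<in>{a..b}. dist s t < d \<longrightarrow> dist (f s) (f t) < \<epsilon>"
  proof (intro exI[of _ \<delta>] conjI ballI impI \<delta>)
    fix s assume "s \<in> {a..b}" "dist s t < \<delta>"
    then show "dist (f s) (f t) < \<epsilon>"
      using *[of s t] *[of t s] t by (cases "s \<le> t") (auto simp: dist_real_def dist_commute)
  qed
qed

text \<open>
  Cousin's lemma yields a tagged division on which the increments with a good tag are controlled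
  by the derivative bound. The intervals with a tag in the null set lie in an open set of small
  measure, so absolute continuity controls their increments.
\<close>

lemma abs_continuous_on_nonincreasing:
  fixes f :: "real \<Rightarrow> real"
  assumes f: "abs_continuous_on {a..b} f" and "a \<le> b" and N: "negligible N"
    and der: "\<And>t \<epsilon>. t \<in> {a..b} - N \<Longrightarrow> \<epsilon> > 0 \<Longrightarrow>
      \<exists>d>0. \<forall>u v. u \<in> {a..t} \<and> v \<in> {t..b} \<and> t - u < d \<and> v - t < d \<longrightarrow> f v - f u \<le> \<epsilon> * (v - u)"
  shows "f b \<le> f a"
proof -
  have main: "f b - f a \<le> \<epsilon> * (b - a + 1)" if "\<epsilon> > 0" for \<epsilon>
  proof -
    from f \<open>\<epsilon> > 0\<close> obtain \<delta> where \<delta>: "\<delta> > 0" and f\<delta>: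
      "\<And>\<D>. \<D> division_of \<Union>\<D> \<Longrightarrow> \<Union>\<D> \<subseteq> {a..b} \<Longrightarrow> (\<Sum>K\<in>\<D>. Sup K - Inf K) < \<delta>
        \<Longrightarrow> (\<Sum>K\<in>\<D>. dist (f (Inf K)) (f (Sup K))) < \<epsilon>"
      by (rule abs_continuous_onD) blast
    have N0: "N \<in> null_sets lebesgue" using N by (simp add: negligible_iff_null_sets)
    then have "N \<in> sets lebesgue" by auto
    then obtain U where U: "open U" "N \<subseteq> U" "U - N \<in> lmeasurable" "emeasure lebesgue (U - N) < ennreal \<delta>"
      using sets_lebesgue_outer_open \<delta> by metis
    have "U \<in> sets lebesgue" using U(1) by (simp add: borel_open)
    then have eU: "emeasure lebesgue U < ennreal \<delta>"
      using emeasure_Diff_null_set[OF N0] U(4) by metis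
    then have Um: "U \<in> lmeasurable"
      using \<open>U \<in> sets lebesgue\<close> by (intro fmeasurableI) (auto intro: order.strict_trans[OF _ ennreal_less_top])
    have mU: "measure lebesgue U < \<delta>"
      using eU emeasure_eq_measure2[OF Um] \<delta> by (simp add: ennreal_less_iff)
    have "\<forall>t. \<exists>d. t \<in> {a..b} - N \<longrightarrow> d > 0 \<and> (\<forall>u v. u \<in> {a..t} \<and> v \<in> {t..b} \<and> t - u < d \<and> v - t < d
          \<longrightarrow> f v - f u \<le> \<epsilon> * (v - u))"
      using der[OF _ \<open>\<epsilon> > 0\<close>] by blast
    then obtain d where d: "\<And>t. t \<in> {a..b} - N \<Longrightarrow> d t > 0"
      "\<And>t u v. t \<in> {a..b} - N \<Longrightarrow> u \<in> {a..t} \<Longrightarrow> v \<in> {t..b} \<Longrightarrow> t - u < d t \<Longrightarrow> v - t < d t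
          \<Longrightarrow> f v - f u \<le> \<epsilon> * (v - u)"
      by metis
    \<comment> \<open>Bad tags force their interval into \<open>U\<close>, good tags into the range
      of the slope bound. Tags of a division of \<open>{a..b}\<close> lie in \<open>{a..b}\<close>,
      so \<open>UNIV\<close> is only a default.\<close>
    define g where "g t = (if t \<in> N then U else if t \<in> {a..b} then ball t (d t) else UNIV)" for t
    have "gauge g" unfolding gauge_def g_def using U d(1) by auto
    then obtain p where p: "p tagged_division_of {a..b}" "g fine p"
      by (rule fine_division_exists_real)
    define p1 where "p1 = {(x, K) \<in> p. x \<in> N}"
    define p2 where "p2 = {(x, K) \<in> p. x \<notin> N}"
    have fin: "finite p" using p(1) by (rule tagged_division_of_finite)
    have p12: "p = p1 \<union> p2" "p1 \<inter> p2 = {}" "p1 \<subseteq> p" "finite p1" "finite p2"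
      using finite_subset[OF _ fin, of p1] finite_subset[OF _ fin, of p2] by (auto simp: p1_def p2_def)
    have Kp: "\<exists>u v. K = {u..v} \<and> u \<le> v \<and> Inf K = u \<and> Sup K = v \<and> u \<in> {a..x} \<and> v \<in> {x..b}"
      if xK: "(x, K) \<in> p" for x K
    proof -
      obtain u v where K: "K = cbox u v" using tagged_division_ofD(4)[OF p(1) xK] by auto
      have "x \<in> K" "K \<subseteq> {a..b}" using tagged_division_ofD(2,3)[OF p(1) xK] by auto
      then have "a \<le> u \<and> u \<le> x \<and> x \<le> v \<and> v \<le> b" using K by auto
      then show ?thesis using K by (intro exI[of _ u] exI[of _ v]) auto
    qed
    have p1: "p1 tagged_partial_division_of {a..b}"
      using p(1) p12(3) tagged_partial_division_subset unfolding tagged_division_of_def by blast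
    have D: "snd ` p1 division_of \<Union>(snd ` p1)" using p1 by (rule partial_division_of_tagged_division)
    have sub: "\<Union>(snd ` p1) \<subseteq> {a..b} \<inter> U"
    proof -
      have "K \<subseteq> {a..b} \<inter> U" if "(x, K) \<in> p1" for x K
        using that p(2) tagged_division_ofD(3)[OF p(1), of x K]
        by (fastforce simp: p1_def fine_def g_def)
      then show ?thesis by force
    qed
    have "measure lebesgue (\<Union>(snd ` p1)) \<le> measure lebesgue U"
      using sub Um lmeasurable_division[OF D] by (intro measure_mono_fmeasurable) auto
    then have "(\<Sum>K\<in>snd ` p1. Sup K - Inf K) < \<delta>"
      using division_of_Sup_diff_Inf[OF D] mU by simp
    then have "(\<Sum>K\<in>snd ` p1. dist (f (Inf K)) (f (Sup K))) < \<epsilon>"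
      using f\<delta>[OF D] sub by blast
    moreover have "(\<Sum>(x, K)\<in>p1. dist (f (Inf K)) (f (Sup K))) = (\<Sum>K\<in>snd ` p1. dist (f (Inf K)) (f (Sup K)))"
      using p1 by (rule sum_tagged_partial_division) simp
    moreover have "(\<Sum>(x, K)\<in>p1. f (Sup K) - f (Inf K)) \<le> (\<Sum>(x, K)\<in>p1. dist (f (Inf K)) (f (Sup K)))"
      by (intro sum_mono) (auto simp: dist_real_def)
    ultimately have s1: "(\<Sum>(x, K)\<in>p1. f (Sup K) - f (Inf K)) \<le> \<epsilon>" by linarith
    have "(\<Sum>(x, K)\<in>p2. f (Sup K) - f (Inf K)) \<le> (\<Sum>(x, K)\<in>p2. \<epsilon> * (Sup K - Inf K))"
    proof (rule sum_mono, clarify)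
      fix x K assume "(x, K) \<in> p2"
      then have xK: "(x, K) \<in> p" "x \<notin> N" by (auto simp: p2_def)
      from Kp[OF xK(1)] obtain u v where uv: "K = {u..v}" "u \<le> v" "Inf K = u" "Sup K = v"
        "u \<in> {a..x}" "v \<in> {x..b}" by blast
      have x: "x \<in> {a..b} - N" using uv xK by auto
      have "K \<subseteq> ball x (d x)" using fineD[OF p(2) xK(1)] x by (simp add: g_def)
      moreover have "u \<in> K" "v \<in> K" using uv by auto
      ultimately have "u \<in> ball x (d x)" "v \<in> ball x (d x)" by blast+
      then have "x - u < d x" "v - x < d x" by (auto simp: dist_real_def)
      then show "f (Sup K) - f (Inf K) \<le> \<epsilon> * (Sup K - Inf K)"
        using d(2)[OF x] uv by auto
    qed
    \<comment> \<open>Returning to all of \<open>p\<close> adds nonnegative terms and makes the sum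
      of lengths telescope.\<close>
    also have "\<dots> \<le> (\<Sum>(x, K)\<in>p. \<epsilon> * (Sup K - Inf K))"
    proof (rule sum_mono2[OF fin])
      show "p2 \<subseteq> p" using p12 by auto
      fix y assume "y \<in> p - p2"
      then show "0 \<le> (case y of (x, K) \<Rightarrow> \<epsilon> * (Sup K - Inf K))"
        using Kp \<open>\<epsilon> > 0\<close> by (cases y) fastforce
    qed
    also have "\<dots> = \<epsilon> * (b - a)"
      using additive_tagged_division_1[OF \<open>a \<le> b\<close> p(1), of "\<lambda>t. \<epsilon> * t"] by (simp add: right_diff_distrib)
    finally have s2: "(\<Sum>(x, K)\<in>p2. f (Sup K) - f (Inf K)) \<le> \<epsilon> * (b - a)" .
    have "f b - f a = (\<Sum>(x, K)\<in>p. f (Sup K) - f (Inf K))"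
      using additive_tagged_division_1[OF \<open>a \<le> b\<close> p(1), of f] by simp
    also have "\<dots> = (\<Sum>(x, K)\<in>p1. f (Sup K) - f (Inf K)) + (\<Sum>(x, K)\<in>p2. f (Sup K) - f (Inf K))"
      using p12 by (simp add: sum.union_disjoint)
    finally show ?thesis using s1 s2 by (simp add: algebra_simps)
  qed
  have "f b \<le> f a + e" if "e > 0" for e
    using main[of "e / (b - a + 1)"] that \<open>a \<le> b\<close> by simp
  then show ?thesis by (rule field_le_epsilon)
qed

text \<open>Subtracting \<open>c * t\<close> reduces this to
  \<open>abs_continuous_on_nonincreasing\<close>. The hypothesis bounds only upper slopes across
  \<open>t\<close>, which suits \<open>W (x t)\<close> for a convex \<open>W\<close> that may fail
  to be differentiable.\<close>

lemma abs_continuous_on_mean_value: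
  fixes f :: "real \<Rightarrow> real"
  assumes f: "abs_continuous_on {a..b} f" and "a \<le> b" and N: "negligible N"
    and der: "\<And>t \<epsilon>. t \<in> {a..b} - N \<Longrightarrow> \<epsilon> > 0 \<Longrightarrow>
      \<exists>d>0. \<forall>u v. u \<in> {a..t} \<and> v \<in> {t..b} \<and> t - u < d \<and> v - t < d \<longrightarrow> f v - f u \<le> (c + \<epsilon>) * (v - u)"
  shows "f b - f a \<le> c * (b - a)"
proof -
  have "f b - c * b \<le> f a - c * a"
  proof (rule abs_continuous_on_nonincreasing[OF _ \<open>a \<le> b\<close> N])
    show "abs_continuous_on {a..b} (\<lambda>t. f t - c * t)"
    proof (rule abs_continuous_on_dominated[OF f, of 1 "\<bar>c\<bar>"])
      fix u v
      have "f u - c * u - (f v - c * v) = (f u - f v) + c * (v - u)" by (simp add: algebra_simps)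
      then show "dist (f u - c * u) (f v - c * v) \<le> 1 * dist (f u) (f v) + \<bar>c\<bar> * \<bar>v - u\<bar>"
        using abs_triangle_ineq[of "f u - f v" "c * (v - u)"] by (simp add: dist_real_def abs_mult)
    qed auto
  next
    fix t \<epsilon> assume "t \<in> {a..b} - N" "\<epsilon> > (0::real)"
    from der[OF this] show "\<exists>d>0. \<forall>u v. u \<in> {a..t} \<and> v \<in> {t..b} \<and> t - u < d \<and> v - t < d \<longrightarrow>
        f v - c * v - (f u - c * u) \<le> \<epsilon> * (v - u)"
      by (simp add: algebra_simps)
  qed
  then show ?thesis by (simp add: algebra_simps)
qed

section \<open>Caratheodory solutions\<close>

lemma has_vector_derivative_withinD:
  assumes "(x has_vector_derivative D) (at t within S)" "\<epsilon> > 0"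
  obtains d where "d > 0"
    "\<And>s. s \<in> S \<Longrightarrow> \<bar>s - t\<bar> < d \<Longrightarrow> norm (x s - x t - (s - t) *\<^sub>R D) \<le> \<epsilon> * \<bar>s - t\<bar>"
  using assms unfolding has_vector_derivative_def has_derivative_within_alt by fastforce

text \<open>Pairing with the fixed vector \<open>w = x b - x a\<close> makes the estimate scalar:
  the mean value inequality gives \<open>norm w * norm w \<le> norm w * (B * (b - a))\<close>, and
  \<open>norm w\<close> cancels.\<close>

lemma abs_continuous_on_norm_diff_le:
  fixes x :: "real \<Rightarrow> 'a::real_inner"
  assumes x: "abs_continuous_on {a..b} x" and "a \<le> b" and N: "negligible N"
    and der: "\<And>t. t \<in> {a..b} - N \<Longrightarrow> (x has_vector_derivative x' t) (at t within {a..b})"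
    and le: "\<And>t. t \<in> {a..b} - N \<Longrightarrow> norm (x' t) \<le> B"
  shows "norm (x b - x a) \<le> B * (b - a)"
proof -
  define w where "w = x b - x a"
  have "w \<bullet> x b - w \<bullet> x a \<le> (norm w * B) * (b - a)"
  proof (rule abs_continuous_on_mean_value[OF _ \<open>a \<le> b\<close> N])
    show "abs_continuous_on {a..b} (\<lambda>t. w \<bullet> x t)"
    proof (rule abs_continuous_on_dominated[OF x, of "norm w" 0])
      fix u v
      show "dist (w \<bullet> x u) (w \<bullet> x v) \<le> norm w * dist (x u) (x v) + 0 * \<bar>v - u\<bar>"
        using Cauchy_Schwarz_ineq2[of w "x u - x v"] by (simp add: dist_norm inner_diff_right)
    qed auto
  next
    fix t \<epsilon> assume t: "t \<in> {a..b} - N" and "\<epsilon> > (0::real)"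
    define e where "e = \<epsilon> / (norm w + 1)"
    have "norm w + 1 > 0" using norm_ge_zero[of w] by linarith
    then have "e > 0" and e: "norm w * e \<le> \<epsilon>" using \<open>\<epsilon> > 0\<close> by (auto simp: e_def field_simps)
    from der[OF t] \<open>e > 0\<close> obtain d where d: "d > 0" "\<And>s. s \<in> {a..b} \<Longrightarrow> \<bar>s - t\<bar> < d
        \<Longrightarrow> norm (x s - x t - (s - t) *\<^sub>R x' t) \<le> e * \<bar>s - t\<bar>"
      by (rule has_vector_derivative_withinD) blast
    have "w \<bullet> x v - w \<bullet> x u \<le> (norm w * B + \<epsilon>) * (v - u)"
      if uv: "u \<in> {a..t}" "v \<in> {t..b}" "t - u < d" "v - t < d" for u v
    proof -
      have 1: "norm (x v - x t - (v - t) *\<^sub>R x' t) \<le> e * (v - t)"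
        and 2: "norm (x u - x t - (u - t) *\<^sub>R x' t) \<le> e * (t - u)"
        using d(2)[of v] d(2)[of u] uv t by auto
      have "norm (x v - x u) = norm ((v - u) *\<^sub>R x' t + (x v - x t - (v - t) *\<^sub>R x' t)
          - (x u - x t - (u - t) *\<^sub>R x' t))"
        by (simp add: algebra_simps)
      also have "\<dots> \<le> norm ((v - u) *\<^sub>R x' t) + norm (x v - x t - (v - t) *\<^sub>R x' t)
          + norm (x u - x t - (u - t) *\<^sub>R x' t)"
        by (meson add_mono norm_triangle_ineq norm_triangle_ineq4 order_refl order_trans)
      also have "\<dots> \<le> (v - u) * B + e * (v - t) + e * (t - u)"
        using 1 2 le[OF t] uv by (intro add_mono) (auto intro!: mult_left_mono)
      also have "\<dots> = (B + e) * (v - u)" by (simp add: algebra_simps)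
      finally have "norm w * norm (x v - x u) \<le> norm w * ((B + e) * (v - u))"
        by (intro mult_left_mono) auto
      then have "w \<bullet> (x v - x u) \<le> norm w * ((B + e) * (v - u))"
        using norm_cauchy_schwarz[of w "x v - x u"] by linarith
      also have "\<dots> = (norm w * B + norm w * e) * (v - u)" by (simp add: algebra_simps)
      also have "\<dots> \<le> (norm w * B + \<epsilon>) * (v - u)" using e uv by (intro mult_right_mono) auto
      finally show ?thesis by (simp add: inner_diff_right)
    qed
    then show "\<exists>d>0. \<forall>u v. u \<in> {a..t} \<and> v \<in> {t..b} \<and> t - u < d \<and> v - t < d \<longrightarrow>
        w \<bullet> x v - w \<bullet> x u \<le> (norm w * B + \<epsilon>) * (v - u)"
      using d(1) by blast
  qed
  then have *: "norm w * norm w \<le> norm w * (B * (b - a))"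
    by (simp add: w_def inner_diff_right[symmetric] power2_norm_eq_inner[symmetric] power2_eq_square)
  show ?thesis
  proof (cases "w = 0")
    case True
    \<comment> \<open>Nothing cancels when \<open>w = 0\<close>, so the sign of \<open>B\<close> is
      needed: a nondegenerate interval is not negligible and hence contains a point where
      \<open>B\<close> bounds a norm.\<close>
    have "0 \<le> B * (b - a)"
    proof (cases "a = b")
      case False
      have "\<not> {a..b} \<subseteq> N"
        using negligible_subset[OF N] negligible_interval(1)[of a b] False \<open>a \<le> b\<close>
        by (auto simp: box_real)
      then obtain t where "t \<in> {a..b} - N" by blast
      from le[OF this] have "0 \<le> B" using norm_ge_zero order_trans by blast
      then show ?thesis using \<open>a \<le> b\<close> by simp
    qed simp
    then show ?thesis using True by (simp add: w_def)
  next
    case False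
    then show ?thesis using * by (simp add: w_def)
  qed
qed

lemma AE_lebesgue_on_iff_negligible:
  assumes "S \<in> sets lebesgue"
  shows "(AE t in lebesgue_on S. Q t) \<longleftrightarrow> (\<exists>N. negligible N \<and> (\<forall>t\<in>S - N. Q t))"
proof -
  have "(AE t in lebesgue_on S. Q t) \<longleftrightarrow> (AE t in lebesgue. t \<in> S \<longrightarrow> Q t)"
    using assms by (intro AE_restrict_space_iff) auto
  also have "\<dots> \<longleftrightarrow> (\<exists>N. negligible N \<and> (\<forall>t\<in>S - N. Q t))"
    by (auto simp: eventually_ae_filter negligible_iff_null_sets)
  finally show ?thesis .
qed

lemma solution_fromE:
  assumes "solution_from s F x"
  obtains N where "negligible N"
    "\<And>t. t \<in> {s..} - N \<Longrightarrow> (x has_vector_derivative F t (x t)) (at t within {s..})"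
    "\<And>a b. s \<le> a \<Longrightarrow> abs_continuous_on {a..b} x"
proof -
  have "AE t in lebesgue_on {s..}. (x has_vector_derivative F t (x t)) (at t within {s..})"
    using assms by (simp add: solution_from_def)
  then obtain N where N: "negligible N"
    "\<And>t. t \<in> {s..} - N \<Longrightarrow> (x has_vector_derivative F t (x t)) (at t within {s..})"
    by (subst (asm) AE_lebesgue_on_iff_negligible) auto
  have "abs_continuous_on {a..b} x" if "s \<le> a" for a b
  proof (rule abs_continuous_on_subset)
    show "abs_continuous_on {s..max s b} x" using assms by (simp add: solution_from_def)
  qed (use that in auto)
  with N show thesis by (rule that)
qed

lemma solution_from_continuous_on:
  assumes "solution_from s F x"
  shows "continuous_on {s..} x"
  unfolding continuous_on_eq_continuous_within
proof
  fix t assume t: "t \<in> {s..}"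
  have "abs_continuous_on {s..t + 1} x" using assms t by (simp add: solution_from_def)
  then have "continuous_on {s..t + 1} x" by (rule abs_continuous_on_imp_continuous_on)
  then have "continuous (at t within {s..t + 1}) x"
    using t by (auto simp: continuous_on_eq_continuous_within)
  moreover have "at t within {s..t + 1} = at t within {s..}"
    by (rule at_within_nhd[of t "{..<t + 1}"]) auto
  ultimately show "continuous (at t within {s..}) x" by simp
qed

text \<open>On an interval of radius \<open>h\<close> about a zero, with
  \<open>K * h \<le> 1/2\<close>, the maximum of \<open>norm (x t)\<close> is at most half of
  itself, hence 0. The zero set is therefore open and closed in the connected set
  \<open>{s..}\<close>. The argument runs in both time directions, so it gives uniqueness and also
  shows that a nonzero solution never reaches 0.\<close>

lemma solution_from_zero:
  fixes x :: "real \<Rightarrow> 'a::real_inner"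
  assumes sol: "solution_from s F x" and "K \<ge> 0"
    and bd: "\<And>t. t \<ge> s \<Longrightarrow> norm (F t (x t)) \<le> K * norm (x t)"
    and zero: "s \<le> \<tau>" "x \<tau> = 0" and "s \<le> t"
  shows "x t = 0"
proof -
  from sol obtain N where N: "negligible N"
    "\<And>t. t \<in> {s..} - N \<Longrightarrow> (x has_vector_derivative F t (x t)) (at t within {s..})"
    "\<And>a b. s \<le> a \<Longrightarrow> abs_continuous_on {a..b} x"
    by (rule solution_fromE) blast
  note cont = solution_from_continuous_on[OF sol]
  define h where "h = 1 / (2 * (K + 1))"
  have h: "h > 0" "K * h \<le> 1/2" using \<open>K \<ge> 0\<close> by (auto simp: h_def field_simps)
  have local: "x r = 0" if \<rho>: "s \<le> \<rho>" "x \<rho> = 0" and r: "s \<le> r" "\<bar>r - \<rho>\<bar> < h" for \<rho> r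
  proof -
    define I where "I = {max s (\<rho> - h)..\<rho> + h}"
    have I: "I \<subseteq> {s..}" "\<rho> \<in> I" "r \<in> I" "compact I" using \<rho> r h by (auto simp: I_def)
    have "continuous_on I (\<lambda>t. norm (x t))"
      using cont I(1) by (intro continuous_intros continuous_on_subset[OF cont])
    then have "\<exists>m\<in>I. \<forall>t\<in>I. norm (x t) \<le> norm (x m)"
      using I(2,4) by (intro continuous_attains_sup) auto
    then obtain m where m: "m \<in> I" "\<And>t. t \<in> I \<Longrightarrow> norm (x t) \<le> norm (x m)" by blast
    \<comment> \<open>Ordering \<open>m\<close> and \<open>\<rho>\<close> lets one estimate treat a
      maximum on either side of the zero.\<close>
    define a where "a = min m \<rho>"
    define b where "b = max m \<rho>"
    have ab: "a \<le> b" "s \<le> a" "{a..b} \<subseteq> I" "b - a \<le> h"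
      using m(1) \<rho> h by (auto simp: a_def b_def I_def)
    have "norm (x b - x a) \<le> (K * norm (x m)) * (b - a)"
    proof (rule abs_continuous_on_norm_diff_le[where x' = "\<lambda>t. F t (x t)", OF N(3)[OF ab(2)] ab(1) N(1)])
      fix t assume t: "t \<in> {a..b} - N"
      show "(x has_vector_derivative F t (x t)) (at t within {a..b})"
        by (rule has_vector_derivative_within_subset[OF N(2)]) (use t ab in auto)
      have "norm (F t (x t)) \<le> K * norm (x t)" using bd t ab by auto
      also have "\<dots> \<le> K * norm (x m)" using m(2) t ab \<open>K \<ge> 0\<close> by (intro mult_left_mono) auto
      finally show "norm (F t (x t)) \<le> K * norm (x m)" .
    qed
    moreover have "norm (x b - x a) = norm (x m)"
      using \<rho>(2) by (auto simp: a_def b_def min_def max_def)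
    moreover have "(K * norm (x m)) * (b - a) \<le> (K * norm (x m)) * h"
      using ab \<open>K \<ge> 0\<close> by (intro mult_left_mono) auto
    moreover have "(K * norm (x m)) * h \<le> 1/2 * norm (x m)"
      using mult_right_mono[OF h(2) norm_ge_zero[of "x m"]] by (simp add: algebra_simps)
    ultimately have "norm (x m) \<le> 0" by linarith
    then show "x r = 0" using m(2)[OF I(3)] by simp
  qed
  define Z where "Z = {r \<in> {s..}. x r = 0}"
  have "closedin (top_of_set {s..}) Z"
    unfolding Z_def using cont by (rule continuous_closedin_preimage_constant)
  moreover have "openin (top_of_set {s..}) Z"
    unfolding openin_contains_ball
  proof (intro conjI ballI)
    show "Z \<subseteq> {s..}" by (auto simp: Z_def)
    fix \<rho> assume "\<rho> \<in> Z"
    then have "ball \<rho> h \<inter> {s..} \<subseteq> Z"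
      using local[of \<rho>] by (auto simp: Z_def dist_real_def abs_minus_commute)
    then show "\<exists>e>0. ball \<rho> e \<inter> {s..} \<subseteq> Z" using h(1) by blast
  qed
  moreover have "connected {s..}" by simp
  moreover have "\<tau> \<in> Z" using zero by (simp add: Z_def)
  ultimately have "Z = {s..}" unfolding connected_clopen by blast
  then show ?thesis using \<open>s \<le> t\<close> by (auto simp: Z_def)
qed

lemma solution_from_diff:
  assumes x: "solution_from s F x" and y: "solution_from s F y"
    and lin: "\<And>t a b. F t (a - b) = F t a - F t b"
  shows "solution_from s F (\<lambda>t. x t - y t)"
  unfolding solution_from_def
proof (intro conjI allI impI)
  fix T assume "s \<le> T"
  then show "abs_continuous_on {s..T} (\<lambda>t. x t - y t)"
    using x y by (intro abs_continuous_on_diff) (auto simp: solution_from_def)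
next
  have "AE t in lebesgue_on {s..}. (x has_vector_derivative F t (x t)) (at t within {s..})"
    "AE t in lebesgue_on {s..}. (y has_vector_derivative F t (y t)) (at t within {s..})"
    using x y by (auto simp: solution_from_def)
  then show "AE t in lebesgue_on {s..}.
      ((\<lambda>t. x t - y t) has_vector_derivative F t (x t - y t)) (at t within {s..})"
    by eventually_elim (auto simp: lin intro: has_vector_derivative_diff)
qed

lemma solution_from_unique:
  fixes x y :: "real \<Rightarrow> 'a::real_inner"
  assumes x: "solution_from s F x" and y: "solution_from s F y"
    and lin: "\<And>t a b. F t (a - b) = F t a - F t b"
    and bd: "\<And>t z. t \<ge> s \<Longrightarrow> norm (F t z) \<le> K * norm z" and "K \<ge> 0"
    and "x s = y s" "s \<le> t"
  shows "x t = y t"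
  using solution_from_zero[OF solution_from_diff[OF x y lin] \<open>K \<ge> 0\<close> bd, of s t] assms(6,7) by simp

text \<open>On \<open>{s..T}\<close> the continuous \<open>x\<close> is bounded, hence so is its
  derivative off the finite set \<open>S\<close>. The fundamental theorem of calculus with finitely
  many exceptional points then makes \<open>x\<close> Lipschitz.\<close>

lemma solution_from_piecewise:
  fixes x :: "real \<Rightarrow> 'a::euclidean_space"
  assumes cont: "continuous_on {s..} x" and S: "finite S"
    and der: "\<And>t. t \<in> {s<..} - S \<Longrightarrow> (x has_vector_derivative F t (x t)) (at t)"
    and bd: "\<And>t z. t \<ge> s \<Longrightarrow> norm (F t z) \<le> K * norm z" and "K \<ge> 0"
  shows "solution_from s F x"
  unfolding solution_from_def
proof (intro conjI allI impI)
  fix T assume T: "s \<le> T"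
  have "continuous_on {s..T} (\<lambda>t. norm (x t))"
    by (intro continuous_intros continuous_on_subset[OF cont]) auto
  then have "\<exists>m\<in>{s..T}. \<forall>t\<in>{s..T}. norm (x t) \<le> norm (x m)"
    using T by (intro continuous_attains_sup) auto
  then obtain m where m: "\<And>t. t \<in> {s..T} \<Longrightarrow> norm (x t) \<le> norm (x m)" by blast
  have le: "norm (x v - x u) \<le> K * norm (x m) * (v - u)"
    if uv: "s \<le> u" "u \<le> v" "v \<le> T" for u v
  proof -
    \<comment> \<open>The value 0 at exceptional points and endpoints makes the bound hold on the
      whole closed interval, as \<open>has_integral_bound\<close> requires.\<close>
    define D where "D t = (if t \<in> {u<..<v} - S then F t (x t) else 0)" for t
    have "(D has_integral (x v - x u)) {u..v}"
    proof (rule fundamental_theorem_of_calculus_interior_strong[OF S uv(2)])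
      show "(x has_vector_derivative D t) (at t)" if "t \<in> {u<..<v} - S" for t
        using der[of t] that uv by (simp add: D_def)
      show "continuous_on {u..v} x" using uv by (intro continuous_on_subset[OF cont]) auto
    qed
    moreover have "norm (D t) \<le> K * norm (x m)" if "t \<in> cbox u v" for t
    proof (cases "t \<in> {u<..<v} - S")
      case True
      have "norm (F t (x t)) \<le> K * norm (x t)" using bd True uv by auto
      also have "\<dots> \<le> K * norm (x m)" using m True uv \<open>K \<ge> 0\<close> by (intro mult_left_mono) auto
      finally show ?thesis using True by (simp add: D_def)
    qed (use \<open>K \<ge> 0\<close> in \<open>auto simp: D_def\<close>)
    ultimately show ?thesis
      using has_integral_bound[of "K * norm (x m)" D "x v - x u" u v] \<open>K \<ge> 0\<close> uv by simp
  qed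
  show "abs_continuous_on {s..T} x"
  proof (rule lipschitz_imp_abs_continuous_on[of "K * norm (x m)"])
    show "0 \<le> K * norm (x m)" using \<open>K \<ge> 0\<close> by simp
    fix u v assume "u \<in> {s..T}" "v \<in> {s..T}"
    then show "dist (x u) (x v) \<le> K * norm (x m) * \<bar>v - u\<bar>"
      using le[of u v] le[of v u] by (cases "u \<le> v") (auto simp: dist_norm norm_minus_commute)
  qed
next
  have "negligible (insert s S)" using S by (intro negligible_finite) simp
  moreover have "(x has_vector_derivative F t (x t)) (at t within {s..})" if "t \<in> {s..} - insert s S" for t
    by (rule has_vector_derivative_at_within[OF der]) (use that in auto)
  ultimately have "\<exists>N. negligible N \<and>
      (\<forall>t\<in>{s..} - N. (x has_vector_derivative F t (x t)) (at t within {s..}))" by blast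
  then show "AE t in lebesgue_on {s..}. (x has_vector_derivative F t (x t)) (at t within {s..})"
    by (subst AE_lebesgue_on_iff_negligible) simp_all
qed

section \<open>Piecewise differentiable flows\<close>

lemma norm_matrix_vector_mult_le:
  fixes A :: "real^'n^'m"
  shows "norm (A *v x) \<le> norm A * norm x"
proof -
  have "norm (A *v x) \<le> L2_set (\<lambda>i. norm (A $ i) * norm x) UNIV"
    unfolding norm_vec_def[of "A *v x"]
    by (intro L2_set_mono) (simp_all add: matrix_vector_mul_component Cauchy_Schwarz_ineq2)
  also have "\<dots> = norm A * norm x"
    by (simp add: norm_vec_def[of A] L2_set_left_distrib)
  finally show ?thesis .
qed

lemma norm_matrix_vector_mult_le_bound: "norm A \<le> K \<Longrightarrow> norm (A *v x) \<le> K * norm x"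
  for A :: "real^'n^'m"
  by (meson norm_matrix_vector_mult_le mult_right_mono norm_ge_zero order_trans)

text \<open>Each row of \<open>A ** B\<close> combines the rows of \<open>B\<close> with
  coefficients from a row of \<open>A\<close>, so Cauchy-Schwarz bounds it; the Frobenius norm is
  the \<open>L2_set\<close> of the row norms.\<close>

lemma norm_matrix_matrix_mult_le:
  fixes A :: "real^'n^'m" and B :: "real^'k^'n"
  shows "norm (A ** B) \<le> norm A * norm B"
proof -
  have row: "norm ((A ** B) $ i) \<le> norm (A $ i) * norm B" for i
  proof -
    have "(A ** B) $ i = (\<Sum>k\<in>UNIV. A $ i $ k *\<^sub>R B $ k)"
      by (simp add: vec_eq_iff matrix_matrix_mult_def)
    then have "norm ((A ** B) $ i) \<le> (\<Sum>k\<in>UNIV. \<bar>A $ i $ k\<bar> * \<bar>norm (B $ k)\<bar>)"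
      using norm_sum[of "\<lambda>k. A $ i $ k *\<^sub>R B $ k" UNIV] by simp
    also have "\<dots> \<le> L2_set (\<lambda>k. A $ i $ k) UNIV * L2_set (\<lambda>k. norm (B $ k)) UNIV"
      by (rule L2_set_mult_ineq)
    also have "\<dots> = norm (A $ i) * norm B"
      by (simp add: norm_vec_def L2_set_def)
    finally show ?thesis .
  qed
  have "norm (A ** B) \<le> L2_set (\<lambda>i. norm (A $ i) * norm B) UNIV"
    unfolding norm_vec_def[of "A ** B"] by (intro L2_set_mono row) simp
  also have "\<dots> = norm A * norm B"
    by (simp add: norm_vec_def[of A] L2_set_left_distrib)
  finally show ?thesis .
qed

section \<open>The matrix exponential\<close>

text \<open>A vector is the sum of its components placed on the axes by bounded linear maps. For
  \<open>matrix_exp\<close> this is applied twice, to rows and then to entries.\<close>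

lemma has_vector_derivative_vec_lambda:
  fixes f :: "real \<Rightarrow> 'a::euclidean_space^'n"
  assumes "\<And>i. ((\<lambda>t. f t $ i) has_vector_derivative D $ i) (at t within S)"
  shows "(f has_vector_derivative D) (at t within S)"
proof -
  have lin: "bounded_linear (axis i :: 'a \<Rightarrow> 'a^'n)" for i
    by (simp add: linear_conv_bounded_linear[symmetric] linear_iff axis_def vec_eq_iff)
  have eq: "(\<Sum>i\<in>UNIV. axis i (v $ i)) = v" for v :: "'a^'n"
    by (simp add: vec_eq_iff axis_def)
  have "((\<lambda>t. \<Sum>i\<in>UNIV. axis i (f t $ i)) has_vector_derivative (\<Sum>i\<in>UNIV. axis i (D $ i))) (at t within S)"
    by (intro has_vector_derivative_sum bounded_linear.has_vector_derivative[OF lin] assms)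
  then show ?thesis by (simp add: eq)
qed

text \<open>
  The product of \<^typ>\<open>real^'n^'n\<close> as a type class operation is componentwise, so \<^const>\<open>exp\<close>
  is not available for the matrix exponential.
\<close>

definition matrix_power :: "real^'n^'n \<Rightarrow> nat \<Rightarrow> real^'n^'n" where
  "matrix_power A k = ((**) A ^^ k) (mat 1)"

definition matrix_exp :: "real^'n^'n \<Rightarrow> real \<Rightarrow> real^'n^'n" where
  "matrix_exp A t = (\<chi> i j. \<Sum>k. matrix_power A k $ i $ j / fact k * t ^ k)"

lemma matrix_power_0 [simp]: "matrix_power A 0 = mat 1"
  and matrix_power_Suc: "matrix_power A (Suc k) = A ** matrix_power A k"
  by (simp_all add: matrix_power_def)

text \<open>The factor \<open>norm (mat 1)\<close> remains because the Frobenius norm of the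
  identity exceeds 1 in dimension above one.\<close>

lemma norm_matrix_power_le: "norm (matrix_power A k) \<le> norm A ^ k * norm (mat 1 :: real^'n^'n)"
  for A :: "real^'n^'n"
proof (induction k)
  case (Suc k)
  have "norm (matrix_power A (Suc k)) \<le> norm A * norm (matrix_power A k)"
    by (simp add: matrix_power_Suc norm_matrix_matrix_mult_le)
  also have "\<dots> \<le> norm A * (norm A ^ k * norm (mat 1 :: real^'n^'n))"
    by (intro mult_left_mono Suc.IH) simp
  finally show ?case by (simp add: mult.assoc)
qed simp

lemma summable_matrix_exp: "summable (\<lambda>k. matrix_power A k $ i $ j / fact k * t ^ k)"
  for A :: "real^'n^'n"
proof (rule summable_comparison_test)
  show "summable (\<lambda>k. norm (mat 1 :: real^'n^'n) * (inverse (fact k) * (norm A * \<bar>t\<bar>) ^ k))"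
    by (intro summable_mult summable_exp)
  have "norm (matrix_power A k $ i $ j / fact k * t ^ k)
      \<le> norm (mat 1 :: real^'n^'n) * (inverse (fact k) * (norm A * \<bar>t\<bar>) ^ k)" for k
  proof -
    have "\<bar>matrix_power A k $ i $ j\<bar> \<le> norm (matrix_power A k)"
      using Finite_Cartesian_Product.norm_nth_le[of "matrix_power A k" i]
        Finite_Cartesian_Product.norm_nth_le[of "matrix_power A k $ i" j] by simp
    also have "\<dots> \<le> norm A ^ k * norm (mat 1 :: real^'n^'n)" by (rule norm_matrix_power_le)
    finally have "\<bar>matrix_power A k $ i $ j\<bar> * (\<bar>t\<bar> ^ k / fact k)
        \<le> (norm A ^ k * norm (mat 1 :: real^'n^'n)) * (\<bar>t\<bar> ^ k / fact k)"
      by (intro mult_right_mono) auto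
    then show ?thesis by (simp add: abs_mult power_abs power_mult_distrib field_simps)
  qed
  then show "\<exists>N. \<forall>k\<ge>N. norm (matrix_power A k $ i $ j / fact k * t ^ k)
      \<le> norm (mat 1 :: real^'n^'n) * (inverse (fact k) * (norm A * \<bar>t\<bar>) ^ k)" by blast
qed

lemma matrix_exp_0 [simp]: "matrix_exp A 0 = mat 1"
  unfolding matrix_exp_def by (subst powser_zero) (simp add: vec_eq_iff)

text \<open>Every entry is an everywhere convergent real power series and may be differentiated
  termwise. The index shift in \<open>diffs\<close> cancels one factor of the factorial and leaves
  the coefficients of \<open>A ** matrix_exp A t\<close>.\<close>

lemma has_vector_derivative_matrix_exp:
  "(matrix_exp A has_vector_derivative A ** matrix_exp A t) (at t within S)"
proof (intro has_vector_derivative_vec_lambda)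
  fix i j
  define c where "c l k = matrix_power A k $ l $ j / fact k" for l k
  have sum: "summable (\<lambda>k. c l k * t ^ k)" for l t
    unfolding c_def by (rule summable_matrix_exp)
  have "((\<lambda>t. \<Sum>k. c i k * t ^ k) has_field_derivative (\<Sum>k. diffs (c i) k * t ^ k)) (at t)"
    by (intro termdiffs_strong_converges_everywhere sum)
  moreover have "(\<Sum>k. diffs (c i) k * t ^ k) = (A ** matrix_exp A t) $ i $ j"
  proof -
    have "diffs (c i) k * t ^ k = (\<Sum>l\<in>UNIV. A $ i $ l * (c l k * t ^ k))" for k
    proof -
      have "diffs (c i) k = (A ** matrix_power A k) $ i $ j / fact k"
        by (simp add: diffs_def c_def matrix_power_Suc del: of_nat_Suc)
      also have "\<dots> = (\<Sum>l\<in>UNIV. A $ i $ l * c l k)"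
        by (simp add: matrix_matrix_mult_def c_def sum_divide_distrib)
      finally show ?thesis by (simp add: sum_distrib_right mult.assoc)
    qed
    then have "(\<Sum>k. diffs (c i) k * t ^ k) = (\<Sum>k. \<Sum>l\<in>UNIV. A $ i $ l * (c l k * t ^ k))" by simp
    also have "\<dots> = (\<Sum>l\<in>UNIV. \<Sum>k. A $ i $ l * (c l k * t ^ k))"
      by (intro suminf_sum summable_mult sum)
    also have "\<dots> = (\<Sum>l\<in>UNIV. A $ i $ l * (\<Sum>k. c l k * t ^ k))"
      by (simp add: suminf_mult sum)
    also have "\<dots> = (A ** matrix_exp A t) $ i $ j"
      by (simp add: matrix_matrix_mult_def matrix_exp_def c_def)
    finally show ?thesis .
  qed
  ultimately have "((\<lambda>t. matrix_exp A t $ i $ j) has_vector_derivative (A ** matrix_exp A t) $ i $ j) (at t)"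
    by (simp add: has_real_derivative_iff_has_vector_derivative matrix_exp_def c_def)
  then show "((\<lambda>t. matrix_exp A t $ i $ j) has_vector_derivative (A ** matrix_exp A t) $ i $ j) (at t within S)"
    by (rule has_vector_derivative_at_within)
qed

lemma continuous_on_matrix_exp: "continuous_on S (matrix_exp A)"
  using has_vector_derivative_matrix_exp has_vector_derivative_continuous
  unfolding continuous_on_eq_continuous_within by blast

lemma matrix_mult_diff_ldistrib: "A ** (B - C) = A ** B - A ** C" for A :: "'a::ring_1^'n^'m"
  by (simp add: vec_eq_iff matrix_matrix_mult_def sum_subtractf right_diff_distrib)

lemma bounded_linear_matrix_mult_left: "bounded_linear (\<lambda>X. X ** C)" for C :: "real^'k^'n"
  by (simp add: linear_conv_bounded_linear[symmetric] linear_iff vec_eq_iff matrix_matrix_mult_def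
      distrib_right sum.distrib sum_distrib_left mult.assoc)

lemma bounded_linear_matrix_vector_mult_left: "bounded_linear (\<lambda>X. X *v x)" for x :: "real^'n"
  by (simp add: linear_conv_bounded_linear[symmetric] linear_iff vec_eq_iff matrix_vector_mult_def
      distrib_right sum.distrib sum_distrib_left mult.assoc)

text \<open>
  The values of fundamental matrices for switching laws with an explicit solution: for these
  \<^const>\<open>fundamental_matrix\<close> is known to be well defined, and they suffice for the Lyapunov function.
\<close>

definition piecewise_flow :: "(real^'n^'n) set \<Rightarrow> real \<Rightarrow> real^'n^'n \<Rightarrow> bool" where
  "piecewise_flow M t X \<longleftrightarrow> (\<exists>B Y S. B \<in> borel_measurable borel \<and> (\<forall>r. B r \<in> M) \<and> finite S \<and>
     continuous_on {0..} Y \<and> Y 0 = mat 1 \<and>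
     (\<forall>r\<in>{0<..} - S. (Y has_vector_derivative B r ** Y r) (at r)) \<and> 0 \<le> t \<and> X = Y t)"

section \<open>Concatenation of flows and their fundamental matrices\<close>

lemma piecewise_flow_nonneg: "piecewise_flow M t X \<Longrightarrow> 0 \<le> t"
  by (auto simp: piecewise_flow_def)

lemma piecewise_flow_matrix_exp:
  assumes "A \<in> M" "0 \<le> t"
  shows "piecewise_flow M t (matrix_exp A t)"
  unfolding piecewise_flow_def
  using assms continuous_on_matrix_exp has_vector_derivative_matrix_exp
  by (intro exI[of _ "\<lambda>_. A"] exI[of _ "matrix_exp A"] exI[of _ "{}"]) auto

text \<open>Run the constant law \<open>A\<close> for time \<open>s\<close>, then the given law
  delayed by \<open>s\<close>. The earlier flow is the right factor, and the exceptional set gains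
  the switching time \<open>s\<close>. This closure property yields the decay of the supremum
  \<open>V\<close>.\<close>

lemma piecewise_flow_prepend:
  fixes X :: "real^'n^'n"
  assumes flow: "piecewise_flow M t X" and A: "A \<in> M" and s: "0 \<le> s"
  shows "piecewise_flow M (s + t) (X ** matrix_exp A s)"
proof -
  from flow obtain B Y S where B: "B \<in> borel_measurable borel" "\<And>r. B r \<in> M" and S: "finite S"
    and Y: "continuous_on {0..} Y" "Y 0 = mat 1"
      "\<And>r. r \<in> {0<..} - S \<Longrightarrow> (Y has_vector_derivative B r ** Y r) (at r)"
    and t: "0 \<le> t" "X = Y t" unfolding piecewise_flow_def by blast
  define B' where "B' r = (if r \<le> s then A else B (r - s))" for r
  define Y' where "Y' r = (if r \<le> s then matrix_exp A r else Y (r - s) ** matrix_exp A s)" for r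
  have "(\<lambda>r. B (r - s)) \<in> borel_measurable borel"
    by (rule measurable_compose[OF _ B(1)]) measurable
  then have 1: "B' \<in> borel_measurable borel" unfolding B'_def by measurable
  have 2: "\<forall>r. B' r \<in> M" using A B(2) by (simp add: B'_def)
  have 3: "finite (insert s ((+) s ` S))" using S by simp
  have contY: "continuous_on {s..} (\<lambda>r. Y (r - s) ** matrix_exp A s)"
  proof (rule bounded_linear.continuous_on[OF bounded_linear_matrix_mult_left])
    show "continuous_on {s..} (\<lambda>r. Y (r - s))"
      by (rule continuous_on_compose2[OF Y(1)]) (auto intro!: continuous_intros)
  qed
  have "continuous_on ({0..s} \<union> {s..}) Y'"
    unfolding Y'_def
    by (rule continuous_on_cases) (use contY Y(2) in \<open>auto intro: continuous_on_matrix_exp\<close>)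
  moreover have "{0..s} \<union> {s..} = {0..}" using s by auto
  ultimately have 4: "continuous_on {0..} Y'" by simp
  have 5: "Y' 0 = mat 1" using s by (simp add: Y'_def)
  have 6: "(Y' has_vector_derivative B' r ** Y' r) (at r)" if r: "r \<in> {0<..} - insert s ((+) s ` S)" for r
  proof (cases "r < s")
    case True
    have "(Y' has_vector_derivative A ** matrix_exp A r) (at r)"
      by (rule has_vector_derivative_transform_within_open[where S = "{..<s}", OF has_vector_derivative_matrix_exp])
        (use True in \<open>auto simp: Y'_def\<close>)
    then show ?thesis using True by (simp add: B'_def Y'_def)
  next
    case False
    then have rs: "r > s" "r - s \<in> {0<..} - S" using r by (auto simp: image_iff)
    have "((\<lambda>r. r - s) has_vector_derivative 1) (at r)"
      by (auto intro!: derivative_eq_intros)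
    then have "((Y \<circ> (\<lambda>r. r - s)) has_vector_derivative 1 *\<^sub>R (B (r - s) ** Y (r - s))) (at r)"
      by (rule vector_diff_chain_at) (use Y(3)[OF rs(2)] in simp)
    then have "((\<lambda>r. Y (r - s)) has_vector_derivative B (r - s) ** Y (r - s)) (at r)"
      by (simp add: o_def)
    then have "((\<lambda>r. Y (r - s) ** matrix_exp A s) has_vector_derivative
        (B (r - s) ** Y (r - s)) ** matrix_exp A s) (at r)"
      by (rule bounded_linear.has_vector_derivative[OF bounded_linear_matrix_mult_left])
    then have "(Y' has_vector_derivative (B (r - s) ** Y (r - s)) ** matrix_exp A s) (at r)"
      by (rule has_vector_derivative_transform_within_open[where S = "{s<..}"])
        (use rs in \<open>auto simp: Y'_def\<close>)
    then show ?thesis using rs by (simp add: B'_def Y'_def matrix_mul_assoc)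
  qed
  \<comment> \<open>For \<open>t = 0\<close> the time \<open>s + t\<close> falls into the first
    branch of \<open>Y'\<close>; the branches agree there because \<open>Y 0\<close> is the
    identity.\<close>
  have 7: "X ** matrix_exp A s = Y' (s + t)"
    using t Y(2) by (cases "t = 0") (auto simp: Y'_def)
  show ?thesis
    unfolding piecewise_flow_def
    by (intro exI[of _ B'] exI[of _ Y'] exI[of _ "insert s ((+) s ` S)"] conjI ballI 1 2 3 4 5 6 7)
      (use s t in auto)
qed

text \<open>The piecewise flow solves the matrix equation, and the bound \<open>K\<close> makes the
  solution unique, so the description in \<open>fundamental_matrix\<close> denotes it. The stability
  estimate thereby applies to every piecewise flow.\<close>

lemma piecewise_flow_fundamental_matrix:
  assumes flow: "piecewise_flow M t X" and M: "\<And>A. A \<in> M \<Longrightarrow> norm A \<le> K"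
  shows "\<exists>B\<in>switching_laws M. fundamental_matrix B t 0 = X"
proof -
  from flow obtain B Y S where B: "B \<in> borel_measurable borel" "\<And>r. B r \<in> M" and S: "finite S"
    and Y: "continuous_on {0..} Y" "Y 0 = mat 1"
      "\<And>r. r \<in> {0<..} - S \<Longrightarrow> (Y has_vector_derivative B r ** Y r) (at r)"
    and t: "0 \<le> t" "X = Y t" unfolding piecewise_flow_def by blast
  have "K \<ge> 0" using M[OF B(2)] norm_ge_zero order_trans by blast
  have bd: "norm (B r ** Z) \<le> K * norm Z" for r and Z :: "real^'a^'a"
    using norm_matrix_matrix_mult_le[of "B r" Z] mult_right_mono[OF M[OF B(2)[of r]] norm_ge_zero[of Z]]
    by linarith
  have sol: "solution_from 0 (\<lambda>r Z. B r ** Z) Y"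
    by (rule solution_from_piecewise[OF Y(1) S Y(3) bd \<open>K \<ge> 0\<close>])
  have "fundamental_matrix B t 0 = X"
    unfolding fundamental_matrix_def
  proof (rule the_equality)
    show "\<exists>Y. solution_from 0 (\<lambda>r Z. B r ** Z) Y \<and> Y 0 = mat 1 \<and> X = Y t"
      using sol Y(2) t(2) by blast
  next
    fix X' assume "\<exists>Y'. solution_from 0 (\<lambda>r Z. B r ** Z) Y' \<and> Y' 0 = mat 1 \<and> X' = Y' t"
    then obtain Y' where Y': "solution_from 0 (\<lambda>r Z. B r ** Z) Y'" "Y' 0 = mat 1" "X' = Y' t" by blast
    have "Y' t = Y t"
      by (rule solution_from_unique[OF Y'(1) sol matrix_mult_diff_ldistrib bd \<open>K \<ge> 0\<close>])
        (use Y' Y(2) t(1) in auto)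
    then show "X' = X" using Y'(3) t(2) by simp
  qed
  moreover have "B \<in> switching_laws M"
    unfolding switching_laws_def
  proof (intro CollectI conjI)
    have "B \<in> borel_measurable lborel" using B(1) by simp
    then have "B \<in> borel_measurable lebesgue" by (rule measurable_completion)
    then show "B \<in> borel_measurable (lebesgue_on {0..})" by (rule measurable_restrict_space1)
  qed (use B(2) in simp)
  ultimately show ?thesis by blast
qed

section \<open>Convex absolutely homogeneous functions\<close>

lemma abs_homogeneousD:
  assumes "V \<in> convex_abs_homogeneous"
  shows "V (c *\<^sub>R x) = \<bar>c\<bar> * V x"
  using assms by (simp add: convex_abs_homogeneous_def absolutely_homogeneous_def)

lemma convex_abs_homogeneous_nonneg: "V \<in> convex_abs_homogeneous \<Longrightarrow> 0 \<le> V x"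
  by (simp add: convex_abs_homogeneous_def)

lemma convex_abs_homogeneous_zero: "V \<in> convex_abs_homogeneous \<Longrightarrow> V 0 = 0"
  using abs_homogeneousD[of V 0 0] by simp

lemma convex_abs_homogeneous_minus: "V \<in> convex_abs_homogeneous \<Longrightarrow> V (- x) = V x"
  using abs_homogeneousD[of V "-1" x] by simp

text \<open>Doubling the midpoint convexity inequality shows that these functions are
  seminorms.\<close>

lemma convex_abs_homogeneous_triangle:
  assumes V: "V \<in> convex_abs_homogeneous"
  shows "V (x + y) \<le> V x + V y"
proof -
  have "convex_on UNIV V" using V by (simp add: convex_abs_homogeneous_def)
  then have "V ((1 - 1/2) *\<^sub>R x + (1/2) *\<^sub>R y) \<le> (1 - 1/2) * V x + (1/2) * V y"
    by (rule convex_onD) auto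
  moreover have "V (x + y) = 2 * V ((1 - 1/2) *\<^sub>R x + (1/2) *\<^sub>R y)"
    using abs_homogeneousD[OF V, of 2 "(1 - 1/2) *\<^sub>R x + (1/2) *\<^sub>R y"] by (simp add: scaleR_add_right)
  ultimately show ?thesis by simp
qed

lemma convex_abs_homogeneousI:
  fixes V :: "real^'n \<Rightarrow> real"
  assumes scale: "\<And>c x. V (c *\<^sub>R x) = \<bar>c\<bar> * V x" and triangle: "\<And>x y. V (x + y) \<le> V x + V y"
  shows "V \<in> convex_abs_homogeneous"
proof -
  have "0 \<le> V x" for x
    using triangle[of x "- x"] scale[of "-1" x] scale[of 0 0] by simp
  moreover have "convex_on UNIV V"
    by (rule convex_onI) (use triangle scale in \<open>auto intro: order_trans[OF triangle]\<close>)
  ultimately show ?thesis using scale by (simp add: convex_abs_homogeneous_def absolutely_homogeneous_def)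
qed

lemma convex_abs_homogeneous_diff_le:
  assumes V: "V \<in> convex_abs_homogeneous" and le: "\<And>x. V x \<le> L * norm x"
  shows "\<bar>V x - V y\<bar> \<le> L * norm (x - y)"
  using convex_abs_homogeneous_triangle[OF V, of "x - y" y] convex_abs_homogeneous_triangle[OF V, of "y - x" x]
    convex_abs_homogeneous_minus[OF V, of "x - y"] le[of "x - y"] by auto

lemma abs_diff_le_from_sphere:
  assumes V: "V \<in> convex_abs_homogeneous" and W: "W \<in> convex_abs_homogeneous"
    and le: "\<And>x. x \<in> sphere 0 1 \<Longrightarrow> \<bar>W x - V x\<bar> \<le> \<delta>"
  shows "\<bar>W x - V x\<bar> \<le> \<delta> * norm x"
proof (cases "x = 0")
  case True
  then show ?thesis by (simp add: convex_abs_homogeneous_zero[OF V] convex_abs_homogeneous_zero[OF W])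
next
  case False
  define y where "y = (1 / norm x) *\<^sub>R x"
  have x: "x = norm x *\<^sub>R y" and y: "y \<in> sphere 0 1" using False by (auto simp: y_def)
  have "W x - V x = norm x * (W y - V y)"
    using abs_homogeneousD[OF V, of "norm x" y] abs_homogeneousD[OF W, of "norm x" y]
    unfolding x[symmetric] by (simp add: right_diff_distrib)
  then have "\<bar>W x - V x\<bar> = norm x * \<bar>W y - V y\<bar>" by (simp add: abs_mult)
  then show ?thesis using mult_left_mono[OF le[OF y] norm_ge_zero[of x]] by (simp add: mult.commute)
qed

lemma SUP_convex_abs_homogeneous:
  fixes q :: "'i \<Rightarrow> real^'n \<Rightarrow> real"
  assumes ne: "I \<noteq> {}" and q: "\<And>i. i \<in> I \<Longrightarrow> q i \<in> convex_abs_homogeneous"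
    and le: "\<And>i x. i \<in> I \<Longrightarrow> q i x \<le> C * norm x"
  shows "(\<lambda>x. SUP i\<in>I. q i x) \<in> convex_abs_homogeneous"
proof (rule convex_abs_homogeneousI)
  have bdd: "bdd_above ((\<lambda>i. q i x) ` I)" for x
    using le by (intro bdd_aboveI2[of _ _ "C * norm x"])
  have upper: "q i x \<le> (SUP i\<in>I. q i x)" if "i \<in> I" for i x
    using that bdd by (rule cSUP_upper)
  have sub: "(SUP i\<in>I. q i (c *\<^sub>R x)) \<le> \<bar>c\<bar> * (SUP i\<in>I. q i x)" for c x
    using ne by (rule cSUP_least) (auto simp: abs_homogeneousD[OF q] intro!: mult_left_mono upper)
  show "(SUP i\<in>I. q i (c *\<^sub>R x)) = \<bar>c\<bar> * (SUP i\<in>I. q i x)" for c x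
  proof (cases "c = 0")
    case True
    then show ?thesis using ne by (simp add: convex_abs_homogeneous_zero[OF q] cong: SUP_cong)
  next
    case False
    \<comment> \<open>The converse inequality comes from \<open>sub\<close> with the factor
      \<open>1 / c\<close> at the point \<open>c *\<^sub>R x\<close>.\<close>
    have "(SUP i\<in>I. q i x) = (SUP i\<in>I. q i ((1 / c) *\<^sub>R (c *\<^sub>R x)))" using False by simp
    also have "\<dots> \<le> \<bar>1 / c\<bar> * (SUP i\<in>I. q i (c *\<^sub>R x))" by (rule sub)
    finally have "\<bar>c\<bar> * (SUP i\<in>I. q i x) \<le> (SUP i\<in>I. q i (c *\<^sub>R x))"
      using False by (simp add: field_simps)
    then show ?thesis using sub[of c x] by linarith
  qed
  show "(SUP i\<in>I. q i (x + y)) \<le> (SUP i\<in>I. q i x) + (SUP i\<in>I. q i y)" for x y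
    using ne
  proof (rule cSUP_least)
    fix i assume "i \<in> I"
    then show "q i (x + y) \<le> (SUP i\<in>I. q i x) + (SUP i\<in>I. q i y)"
      using convex_abs_homogeneous_triangle[OF q, of i x y] upper[of i x] upper[of i y] by linarith
  qed
qed

lemma norm_mem_convex_abs_homogeneous: "norm \<in> convex_abs_homogeneous"
  by (rule convex_abs_homogeneousI) (auto intro: norm_triangle_ineq)

section \<open>Euler steps and a norm decreasing along them\<close>

lemma norm_diff_le_of_vector_derivative:
  fixes f :: "real \<Rightarrow> 'a::banach"
  assumes "a \<le> b" and der: "\<And>t. t \<in> {a..b} \<Longrightarrow> (f has_vector_derivative f' t) (at t within {a..b})"
    and le: "\<And>t. t \<in> {a..b} \<Longrightarrow> norm (f' t) \<le> B"
  shows "norm (f b - f a) \<le> B * (b - a)"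
proof -
  have "norm (f' a) \<le> B" using le \<open>a \<le> b\<close> by simp
  then have "0 \<le> B" by (rule order_trans[OF norm_ge_zero])
  moreover have "(f' has_integral (f b - f a)) (cbox a b)"
    using fundamental_theorem_of_calculus[OF \<open>a \<le> b\<close> der] by simp
  ultimately have "norm (f b - f a) \<le> B * measure lborel (cbox a b)"
    by (rule has_integral_bound) (use le in simp)
  then show ?thesis using \<open>a \<le> b\<close> by simp
qed

text \<open>Two mean value estimates: the derivative of \<open>y\<close> has norm at most
  \<open>K * C * norm x\<close>, so \<open>y s - x\<close> is of order \<open>h\<close>; then
  \<open>g s = y s - s *\<^sub>R (A *v x)\<close> has derivative \<open>A *v (y s - x)\<close>,
  which gives a remainder of order \<open>h\<^sup>2\<close>.\<close>

lemma norm_matrix_exp_euler_le: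
  fixes A :: "real^'n^'n"
  assumes A: "norm A \<le> K" and h: "0 \<le> h"
    and bd: "\<And>s. s \<in> {0..h} \<Longrightarrow> norm (matrix_exp A s) \<le> C"
  shows "norm (matrix_exp A h *v x - (x + h *\<^sub>R (A *v x))) \<le> K\<^sup>2 * C * h\<^sup>2 * norm x"
proof -
  define y where "y s = matrix_exp A s *v x" for s
  have "K \<ge> 0" using A norm_ge_zero order_trans by blast
  have AK: "norm (A *v z) \<le> K * norm z" for z
    by (rule norm_matrix_vector_mult_le_bound[OF A])
  have dy: "(y has_vector_derivative A *v y s) (at s within S)" for s S
    using bounded_linear.has_vector_derivative[OF bounded_linear_matrix_vector_mult_left
        has_vector_derivative_matrix_exp[of A s S], of x]
    by (simp add: y_def[abs_def] matrix_vector_mul_assoc)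
  have y0: "y 0 = x" by (simp add: y_def)
  have yC: "norm (y s) \<le> C * norm x" if "s \<in> {0..h}" for s
    unfolding y_def by (rule norm_matrix_vector_mult_le_bound[OF bd[OF that]])
  have "norm (matrix_exp A 0) \<le> C" using bd[of 0] h by simp
  then have "C \<ge> 0" by (rule order_trans[OF norm_ge_zero])
  have y1: "norm (y s - x) \<le> K * C * norm x * h" if s: "s \<in> {0..h}" for s
  proof -
    have "norm (y s - y 0) \<le> (K * (C * norm x)) * (s - 0)"
    proof (rule norm_diff_le_of_vector_derivative[OF _ dy])
      fix r assume "r \<in> {0..s}"
      then have "norm (y r) \<le> C * norm x" using yC s by simp
      then show "norm (A *v y r) \<le> K * (C * norm x)"
        using AK[of "y r"] mult_left_mono[OF _ \<open>K \<ge> 0\<close>] order_trans by blast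
    qed (use s in simp)
    also have "\<dots> \<le> (K * (C * norm x)) * h"
      using s \<open>K \<ge> 0\<close> \<open>C \<ge> 0\<close> by (intro mult_left_mono) auto
    finally show ?thesis by (simp add: y0 mult.assoc)
  qed
  define g where "g s = y s - s *\<^sub>R (A *v x)" for s
  have dg: "(g has_vector_derivative A *v (y s - x)) (at s within S)" for s S
  proof -
    have "((\<lambda>s. y s - s *\<^sub>R (A *v x)) has_vector_derivative A *v y s - 1 *\<^sub>R (A *v x)) (at s within S)"
      by (intro has_vector_derivative_diff dy) (auto intro!: derivative_eq_intros)
    then show ?thesis by (simp add: g_def[abs_def] matrix_vector_mult_diff_distrib)
  qed
  have "norm (g h - g 0) \<le> (K * (K * C * norm x * h)) * (h - 0)"
  proof (rule norm_diff_le_of_vector_derivative[OF h dg])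
    fix r assume "r \<in> {0..h}"
    then show "norm (A *v (y r - x)) \<le> K * (K * C * norm x * h)"
      using AK[of "y r - x"] mult_left_mono[OF y1 \<open>K \<ge> 0\<close>] order_trans by blast
  qed
  then show ?thesis
    by (simp add: g_def y0) (simp add: y_def power2_eq_square algebra_simps)
qed

text \<open>For \<open>u\<close> in the unit interval \<open>(1 - u / 2) * (1 + u)\<close> is at
  least 1, and \<open>1 + u \<le> exp u\<close>.\<close>

lemma exp_minus_le:
  fixes u :: real
  assumes "0 \<le> u" "u \<le> 1"
  shows "exp (- u) \<le> 1 - u / 2"
proof -
  have "1 \<le> (1 - u / 2) * (1 + u)" using assms mult_left_mono[of u 1 u] by (simp add: algebra_simps)
  also have "\<dots> \<le> (1 - u / 2) * exp u"
    using assms exp_ge_add_one_self[of u] by (intro mult_left_mono) auto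
  finally show ?thesis by (simp add: exp_minus field_simps)
qed

text \<open>The supremum runs over pairs of a time and a flow value. The pair
  \<open>(0, mat 1)\<close>, available since \<open>M\<close> is nonempty, gives
  \<open>norm x \<le> V x\<close>; stability gives the upper bound.\<close>

lemma uniformly_exponentially_stable_euler_decreasing_norm:
  fixes M :: "(real^'n^'n) set"
  assumes ues: "uniformly_exponentially_stable M" and M: "\<And>A. A \<in> M \<Longrightarrow> norm A \<le> K" and "M \<noteq> {}"
  obtains V C h c where "V \<in> convex_abs_homogeneous" "\<And>x. norm x \<le> V x" "\<And>x. V x \<le> C * norm x"
    "h > 0" "c > 0" "\<And>A x. A \<in> M \<Longrightarrow> V (x + h *\<^sub>R (A *v x)) \<le> V x - c * norm x"
proof -
  obtain C \<gamma> where "C > 0" "\<gamma> > 0" and "\<And>A t. A \<in> switching_laws M \<Longrightarrow> t \<ge> 0 \<Longrightarrow>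
      norm (fundamental_matrix A t 0) \<le> C * exp (- \<gamma> * t)"
    using ues unfolding uniformly_exponentially_stable_def by blast
  then have flow: "norm X \<le> C * exp (- \<gamma> * t)" if "piecewise_flow M t X" for t X
    using piecewise_flow_fundamental_matrix[OF that M] piecewise_flow_nonneg[OF that] by blast
  obtain A0 where A0: "A0 \<in> M" using \<open>M \<noteq> {}\<close> by blast
  define I where "I = {p. piecewise_flow M (fst p) (snd p)}"
  define q where "q p x = exp (\<gamma> * fst p) * norm (snd p *v x)" for p :: "real \<times> (real^'n^'n)" and x
  define V where "V x = (SUP p\<in>I. q p x)" for x
  have id: "(0, mat 1) \<in> I"
    using piecewise_flow_matrix_exp[OF A0, of 0] by (simp add: I_def)
  have q: "q p \<in> convex_abs_homogeneous" for p
  proof (rule convex_abs_homogeneousI)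
    show "q p (c *\<^sub>R x) = \<bar>c\<bar> * q p x" for c x
      by (simp add: q_def matrix_vector_mult_scaleR)
    show "q p (x + y) \<le> q p x + q p y" for x y
      using mult_left_mono[OF norm_triangle_ineq[of "snd p *v x" "snd p *v y"], of "exp (\<gamma> * fst p)"]
      by (simp add: q_def matrix_vector_right_distrib distrib_left)
  qed
  have qC: "q p x \<le> C * norm x" if "p \<in> I" for p x
  proof -
    have "norm (snd p *v x) \<le> (C * exp (- \<gamma> * fst p)) * norm x"
      using that by (intro norm_matrix_vector_mult_le_bound flow) (simp add: I_def)
    then have "q p x \<le> exp (\<gamma> * fst p) * ((C * exp (- \<gamma> * fst p)) * norm x)"
      unfolding q_def by (intro mult_left_mono) auto
    also have "\<dots> = C * norm x" by (simp add: exp_minus field_simps)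
    finally show ?thesis .
  qed
  have V: "V \<in> convex_abs_homogeneous"
    unfolding V_def[abs_def] by (rule SUP_convex_abs_homogeneous[OF _ q qC]) (use id in auto)
  have bdd: "bdd_above ((\<lambda>p. q p x) ` I)" for x
    using qC by (intro bdd_aboveI2[of _ _ "C * norm x"])
  have upper: "q p x \<le> V x" if "p \<in> I" for p x
    unfolding V_def using that bdd by (rule cSUP_upper)
  have Vnorm: "norm x \<le> V x" for x using upper[OF id, of x] by (simp add: q_def)
  have VC: "V x \<le> C * norm x" for x
    unfolding V_def using id qC by (intro cSUP_least) auto
  have Vdec: "V (matrix_exp A s *v x) \<le> exp (- \<gamma> * s) * V x" if A: "A \<in> M" "0 \<le> s" for A s x
    unfolding V_def[of "matrix_exp A s *v x"]
  proof (rule cSUP_least)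
    fix p assume p: "p \<in> I"
    \<comment> \<open>Prepending the flow of \<open>A\<close> turns a competitor at
      \<open>matrix_exp A s *v x\<close> into one at \<open>x\<close>, with weight larger by
      \<open>exp (\<gamma> * s)\<close>.\<close>
    then have "(s + fst p, snd p ** matrix_exp A s) \<in> I"
      using piecewise_flow_prepend A by (simp add: I_def)
    from upper[OF this, of x]
    have "exp (\<gamma> * s) * q p (matrix_exp A s *v x) \<le> V x"
      by (simp add: q_def distrib_left exp_add matrix_vector_mul_assoc)
    then have "exp (- \<gamma> * s) * (exp (\<gamma> * s) * q p (matrix_exp A s *v x)) \<le> exp (- \<gamma> * s) * V x"
      by (intro mult_left_mono) auto
    then show "q p (matrix_exp A s *v x) \<le> exp (- \<gamma> * s) * V x"
      by (simp add: exp_minus field_simps)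
  qed (use id in auto)
  \<comment> \<open>This \<open>h\<close> serves two demands at once:
    \<open>\<gamma> * h \<le> 1\<close> for \<open>exp_minus_le\<close>, and a Euler error
    \<open>C\<^sup>2 * K\<^sup>2 * h\<^sup>2\<close> of at most \<open>\<gamma> * h / 4\<close>,
    half of the decay \<open>\<gamma> * h / 2\<close>.\<close>
  define h where "h = \<gamma> / (\<gamma>\<^sup>2 + 4 * C\<^sup>2 * K\<^sup>2)"
  have den: "\<gamma>\<^sup>2 + 4 * C\<^sup>2 * K\<^sup>2 > 0" using \<open>\<gamma> > 0\<close> by (intro add_pos_nonneg) auto
  have "h > 0" using \<open>\<gamma> > 0\<close> den by (simp add: h_def)
  have hden: "h * (\<gamma>\<^sup>2 + 4 * C\<^sup>2 * K\<^sup>2) = \<gamma>" using den by (simp add: h_def)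
  have "0 \<le> h * (4 * C\<^sup>2 * K\<^sup>2)" "0 \<le> h * \<gamma>\<^sup>2" using \<open>h > 0\<close> by auto
  then have "h * \<gamma>\<^sup>2 \<le> \<gamma>" "h * (4 * C\<^sup>2 * K\<^sup>2) \<le> \<gamma>"
    using hden unfolding distrib_left by linarith+
  then have h1: "\<gamma> * h \<le> 1" and le: "h * (4 * C\<^sup>2 * K\<^sup>2) \<le> \<gamma>"
    using \<open>\<gamma> > 0\<close> by (auto simp: power2_eq_square mult.commute)
  from le have "h * (h * (4 * C\<^sup>2 * K\<^sup>2)) \<le> h * \<gamma>" using \<open>h > 0\<close> by (intro mult_left_mono) auto
  then have h2: "C\<^sup>2 * K\<^sup>2 * h\<^sup>2 \<le> \<gamma> * h / 4" by (simp add: power2_eq_square algebra_simps)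
  have "V (x + h *\<^sub>R (A *v x)) \<le> V x - (\<gamma> * h / 4) * norm x" if A: "A \<in> M" for A x
  proof -
    define z where "z = matrix_exp A h *v x"
    have "norm (matrix_exp A s) \<le> C" if "s \<in> {0..h}" for s
    proof -
      have "norm (matrix_exp A s) \<le> C * exp (- \<gamma> * s)"
        using flow piecewise_flow_matrix_exp[OF A] that by simp
      also have "\<dots> \<le> C * 1" using \<open>C > 0\<close> \<open>\<gamma> > 0\<close> that by (intro mult_left_mono) auto
      finally show ?thesis by simp
    qed
    then have zx: "norm (z - (x + h *\<^sub>R (A *v x))) \<le> K\<^sup>2 * C * h\<^sup>2 * norm x"
      unfolding z_def using M[OF A] \<open>h > 0\<close> by (intro norm_matrix_exp_euler_le) auto
    have "\<bar>V z - V (x + h *\<^sub>R (A *v x))\<bar> \<le> C * norm (z - (x + h *\<^sub>R (A *v x)))"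
      by (rule convex_abs_homogeneous_diff_le[OF V VC])
    also have "\<dots> \<le> C * (K\<^sup>2 * C * h\<^sup>2 * norm x)" using zx \<open>C > 0\<close> by (intro mult_left_mono) auto
    also have "\<dots> = (C\<^sup>2 * K\<^sup>2 * h\<^sup>2) * norm x" by (simp add: power2_eq_square)
    also have "\<dots> \<le> (\<gamma> * h / 4) * norm x" using h2 by (intro mult_right_mono) auto
    finally have 1: "V (x + h *\<^sub>R (A *v x)) \<le> V z + (\<gamma> * h / 4) * norm x" by linarith
    have "V z \<le> exp (- \<gamma> * h) * V x" unfolding z_def using A \<open>h > 0\<close> by (intro Vdec) auto
    also have "\<dots> \<le> (1 - \<gamma> * h / 2) * V x"
      using exp_minus_le[of "\<gamma> * h"] h1 \<open>h > 0\<close> \<open>\<gamma> > 0\<close> convex_abs_homogeneous_nonneg[OF V, of x]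
      by (intro mult_right_mono) auto
    also have "\<dots> = V x - (\<gamma> * h / 2) * V x" by (simp add: algebra_simps)
    also have "\<dots> \<le> V x - (\<gamma> * h / 2) * norm x"
      using mult_left_mono[OF Vnorm[of x], of "\<gamma> * h / 2"] \<open>h > 0\<close> \<open>\<gamma> > 0\<close> by simp
    finally show ?thesis using 1 by (simp add: algebra_simps)
  qed
  moreover have "\<gamma> * h / 4 > 0" using \<open>h > 0\<close> \<open>\<gamma> > 0\<close> by simp
  ultimately show thesis using V Vnorm VC \<open>h > 0\<close> that by blast
qed

text \<open>
  A seminorm that decreases along one Euler step of fixed length has a negative slope along the
  whole ray by convexity, and in particular on both sides of the starting point.
\<close>

lemma euler_step_slopes:
  assumes W: "W \<in> convex_abs_homogeneous" and "h > 0"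
    and dec: "W (x + h *\<^sub>R v) \<le> W x - r"
  shows "0 \<le> s \<Longrightarrow> s \<le> h \<Longrightarrow> W (x + s *\<^sub>R v) \<le> W x - s * r / h"
    and "0 \<le> s \<Longrightarrow> W x \<le> W (x - s *\<^sub>R v) - s * r / h"
proof -
  assume s: "0 \<le> s" "s \<le> h"
  have "h * W (x + s *\<^sub>R v) = W (h *\<^sub>R (x + s *\<^sub>R v))" using \<open>h > 0\<close> by (simp add: abs_homogeneousD[OF W])
  also have "h *\<^sub>R (x + s *\<^sub>R v) = (h - s) *\<^sub>R x + s *\<^sub>R (x + h *\<^sub>R v)" by (simp add: algebra_simps)
  also have "W \<dots> \<le> W ((h - s) *\<^sub>R x) + W (s *\<^sub>R (x + h *\<^sub>R v))"
    by (rule convex_abs_homogeneous_triangle[OF W])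
  also have "\<dots> = (h - s) * W x + s * W (x + h *\<^sub>R v)" using s by (simp add: abs_homogeneousD[OF W])
  also have "\<dots> \<le> (h - s) * W x + s * (W x - r)" using dec s by (intro add_left_mono mult_left_mono) auto
  finally show "W (x + s *\<^sub>R v) \<le> W x - s * r / h" using \<open>h > 0\<close> by (simp add: field_simps)
next
  assume s: "0 \<le> s"
  have "(h + s) * W x = W ((h + s) *\<^sub>R x)" using \<open>h > 0\<close> s by (simp add: abs_homogeneousD[OF W])
  also have "(h + s) *\<^sub>R x = h *\<^sub>R (x - s *\<^sub>R v) + s *\<^sub>R (x + h *\<^sub>R v)" by (simp add: algebra_simps)
  also have "W \<dots> \<le> W (h *\<^sub>R (x - s *\<^sub>R v)) + W (s *\<^sub>R (x + h *\<^sub>R v))"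
    by (rule convex_abs_homogeneous_triangle[OF W])
  also have "\<dots> = h * W (x - s *\<^sub>R v) + s * W (x + h *\<^sub>R v)" using s \<open>h > 0\<close> by (simp add: abs_homogeneousD[OF W])
  also have "\<dots> \<le> h * W (x - s *\<^sub>R v) + s * (W x - r)" using dec s by (intro add_left_mono mult_left_mono) auto
  finally show "W x \<le> W (x - s *\<^sub>R v) - s * r / h" using \<open>h > 0\<close> by (simp add: field_simps)
qed

section \<open>Strict decrease along trajectories\<close>

text \<open>At almost every \<open>t\<close> the trajectory is tangent to the Euler ray, and
  \<open>W\<close> is Lipschitz, so the slope bounds along the ray carry over to
  \<open>W (x t)\<close> up to \<open>\<epsilon>\<close>.\<close>

lemma euler_decreasing_imp_strict_antimono:
  fixes W :: "real^'n \<Rightarrow> real"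
  assumes W: "W \<in> convex_abs_homogeneous" and WL: "\<And>x. W x \<le> L * norm x"
    and "h > 0" "c > 0" and dec: "\<And>A x. A \<in> M \<Longrightarrow> W (x + h *\<^sub>R (A *v x)) \<le> W x - c * norm x"
    and M: "\<And>A. A \<in> M \<Longrightarrow> norm A \<le> K"
    and A: "A \<in> switching_laws M" and x: "trajectory A x" "x 0 \<noteq> 0"
  shows "strict_antimono_on {0..} (\<lambda>t. W (x t))"
proof (rule monotone_onI)
  fix a b :: real assume ab: "a \<in> {0..}" "b \<in> {0..}" "a < b"
  have AM: "A t \<in> M" if "t \<ge> 0" for t using A that by (simp add: switching_laws_def)
  have "K \<ge> 0" using M[OF AM[of 0]] norm_ge_zero[of "A 0"] by linarith
  have "L \<ge> 0"
    using order_trans[OF convex_abs_homogeneous_nonneg[OF W] WL, of "axis undefined 1"] by simp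
  have sol: "solution_from 0 (\<lambda>t y. A t *v y) x" using x(1) by (simp add: trajectory_def)
  have bd: "norm (A t *v z) \<le> K * norm z" if "t \<ge> 0" for t z
    by (rule norm_matrix_vector_mult_le_bound[OF M[OF AM[OF that]]])
  \<comment> \<open>A zero at time \<open>t\<close> would propagate back to time 0.\<close>
  have nz: "x t \<noteq> 0" if "t \<ge> 0" for t
    using solution_from_zero[OF sol \<open>K \<ge> 0\<close> bd that] x(2) by auto
  from sol obtain N where N: "negligible N"
    "\<And>t. t \<in> {0..} - N \<Longrightarrow> (x has_vector_derivative A t *v x t) (at t within {0..})"
    "\<And>a b. 0 \<le> a \<Longrightarrow> abs_continuous_on {a..b} x"
    by (rule solution_fromE) blast
  have xac: "abs_continuous_on {a..b} x" using N(3) ab by simp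
  have "continuous_on {a..b} (\<lambda>t. norm (x t))"
    using abs_continuous_on_imp_continuous_on[OF xac] by (intro continuous_intros)
  then have "\<exists>m\<in>{a..b}. \<forall>t\<in>{a..b}. norm (x m) \<le> norm (x t)"
    using ab by (intro continuous_attains_inf) auto
  then obtain m where m: "m \<in> {a..b}" "\<And>t. t \<in> {a..b} \<Longrightarrow> norm (x m) \<le> norm (x t)" by blast
  \<comment> \<open>The positive minimum of \<open>norm (x t)\<close> on \<open>{a..b}\<close> makes
    the rate of decrease uniform there.\<close>
  define \<kappa> where "\<kappa> = c * norm (x m) / h"
  have "\<kappa> > 0" using nz[of m] m ab \<open>c > 0\<close> \<open>h > 0\<close> by (simp add: \<kappa>_def)
  have lip: "\<bar>W y - W z\<bar> \<le> L * norm (y - z)" for y z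
    by (rule convex_abs_homogeneous_diff_le[OF W WL])
  have "W (x b) - W (x a) \<le> (- \<kappa>) * (b - a)"
  proof (rule abs_continuous_on_mean_value[OF _ _ N(1)])
    show "abs_continuous_on {a..b} (\<lambda>t. W (x t))"
      by (rule abs_continuous_on_dominated[OF xac \<open>L \<ge> 0\<close>, of 0]) (use lip in \<open>auto simp: dist_norm dist_real_def\<close>)
    show "a \<le> b" using ab by simp
    fix t \<epsilon> assume t: "t \<in> {a..b} - N" and "\<epsilon> > (0::real)"
    define v where "v = A t *v x t"
    define e where "e = \<epsilon> / (L + 1)"
    have "e > 0" and e: "L * e \<le> \<epsilon>" using \<open>\<epsilon> > 0\<close> \<open>L \<ge> 0\<close> by (auto simp: e_def field_simps)
    have "(x has_vector_derivative v) (at t within {0..})" unfolding v_def using N(2) t ab by auto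
    from this \<open>e > 0\<close> obtain d where d: "d > 0" "\<And>s. s \<in> {0..} \<Longrightarrow> \<bar>s - t\<bar> < d
        \<Longrightarrow> norm (x s - x t - (s - t) *\<^sub>R v) \<le> e * \<bar>s - t\<bar>"
      by (rule has_vector_derivative_withinD) blast
    have step: "W (x t + h *\<^sub>R v) \<le> W (x t) - c * norm (x t)"
      unfolding v_def using dec AM t ab by simp
    note slopes = euler_step_slopes[OF W \<open>h > 0\<close> step]
    \<comment> \<open>The increment is split at \<open>t\<close>. The radius is capped by
      \<open>h\<close> because the forward slope bound stops at the Euler step.\<close>
    have "W (x s') - W (x s) \<le> (- \<kappa> + \<epsilon>) * (s' - s)"
      if s: "s \<in> {a..t}" "s' \<in> {t..b}" "t - s < min d h" "s' - t < min d h" for s s'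
    proof -
      have 1: "norm (x s' - (x t + (s' - t) *\<^sub>R v)) \<le> e * (s' - t)"
        using d(2)[of s'] s t ab by (simp add: algebra_simps)
      have 2: "norm (x s - (x t - (t - s) *\<^sub>R v)) \<le> e * (t - s)"
        using d(2)[of s] s t ab by (simp add: algebra_simps)
      have "W (x s') \<le> W (x t + (s' - t) *\<^sub>R v) + L * (e * (s' - t))"
        using lip[of "x s'" "x t + (s' - t) *\<^sub>R v"] mult_left_mono[OF 1 \<open>L \<ge> 0\<close>] by linarith
      moreover have "W (x t - (t - s) *\<^sub>R v) \<le> W (x s) + L * (e * (t - s))"
        using lip[of "x s" "x t - (t - s) *\<^sub>R v"] mult_left_mono[OF 2 \<open>L \<ge> 0\<close>] by linarith
      moreover have "W (x t + (s' - t) *\<^sub>R v) \<le> W (x t) - (s' - t) * (c * norm (x t)) / h"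
        using slopes(1)[of "s' - t"] s by simp
      moreover have "W (x t) \<le> W (x t - (t - s) *\<^sub>R v) - (t - s) * (c * norm (x t)) / h"
        using slopes(2)[of "t - s"] s by simp
      ultimately have "W (x s') - W (x s) \<le> L * (e * (s' - t)) + L * (e * (t - s))
          - ((s' - t) * (c * norm (x t)) / h + (t - s) * (c * norm (x t)) / h)" by linarith
      also have "\<dots> = (L * e - c * norm (x t) / h) * (s' - s)"
        using \<open>h > 0\<close> by (simp add: field_simps)
      also have "\<dots> \<le> (- \<kappa> + \<epsilon>) * (s' - s)"
      proof (rule mult_right_mono)
        have "\<kappa> \<le> c * norm (x t) / h"
          unfolding \<kappa>_def using m(2)[of t] t \<open>c > 0\<close> \<open>h > 0\<close> by (intro divide_right_mono mult_left_mono) auto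
        then show "L * e - c * norm (x t) / h \<le> - \<kappa> + \<epsilon>" using e by linarith
      qed (use s in simp)
      finally show ?thesis .
    qed
    then show "\<exists>d>0. \<forall>s s'. s \<in> {a..t} \<and> s' \<in> {t..b} \<and> t - s < d \<and> s' - t < d \<longrightarrow>
        W (x s') - W (x s) \<le> (- \<kappa> + \<epsilon>) * (s' - s)"
      using d(1) \<open>h > 0\<close> by (intro exI[of _ "min d h"]) auto
  qed
  moreover have "\<kappa> * (b - a) > 0" using \<open>\<kappa> > 0\<close> ab by simp
  ultimately show "W (x a) > W (x b)" by simp
qed

section \<open>Passage to an approximant in the class\<close>

theorem proposition3p1:
  fixes P :: "(real^'n \<Rightarrow> real) set"
  assumes "P \<subseteq> convex_abs_homogeneous"
    and "\<And>V \<delta>. V \<in> convex_abs_homogeneous \<Longrightarrow> \<delta> > 0 \<Longrightarrow>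
           \<exists>W\<in>P. \<forall>x\<in>sphere 0 1. \<bar>W x - V x\<bar> \<le> \<delta>"
  shows "universal_lyapunov_class P"
  unfolding universal_lyapunov_class_def
proof (intro allI impI, elim conjE)
  fix M :: "(real^'n^'n) set"
  assume "bounded M" and ues: "uniformly_exponentially_stable M"
  then obtain K where K: "K > 0" "\<And>A. A \<in> M \<Longrightarrow> norm A \<le> K"
    using bounded_pos by blast
  obtain V C h c where V: "V \<in> convex_abs_homogeneous" "\<And>x. norm x \<le> V x" "\<And>x. V x \<le> C * norm x"
    and "h > 0" "c > 0" and dec: "\<And>A x. A \<in> M \<Longrightarrow> V (x + h *\<^sub>R (A *v x)) \<le> V x - c * norm x"
  proof (cases "M = {}")
    \<comment> \<open>Without matrices the decrease condition is vacuous, and the Euclidean norm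
      serves as \<open>V\<close>.\<close>
    case True
    then show thesis using that[of norm 1 1 1] norm_mem_convex_abs_homogeneous by auto
  next
    case False
    then show thesis
      using uniformly_exponentially_stable_euler_decreasing_norm[OF ues K(2)] that by metis
  qed
  \<comment> \<open>The bound 1/2 keeps \<open>W x\<close> at least \<open>norm x / 2\<close>. The
    other bound absorbs the errors at \<open>x\<close> and at
    \<open>x + h *\<^sub>R (A *v x)\<close>, which total at most
    \<open>\<delta> * (2 + h * K) * norm x\<close>, into half of the decrease
    \<open>c * norm x\<close>.\<close>
  define \<delta> where "\<delta> = min (1/2) (c / (2 * (2 + h * K)))"
  have hK: "2 + h * K > 0" using \<open>h > 0\<close> K(1) by (simp add: add_pos_pos)
  have \<delta>: "\<delta> > 0" "\<delta> \<le> 1/2" "\<delta> * (2 + h * K) \<le> c / 2"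
  proof -
    show "\<delta> > 0" "\<delta> \<le> 1/2" using \<open>c > 0\<close> hK unfolding \<delta>_def by (simp_all only: min_less_iff_conj min.cobounded1) simp
    have "\<delta> * (2 + h * K) \<le> c / (2 * (2 + h * K)) * (2 + h * K)"
      using hK by (intro mult_right_mono) (auto simp: \<delta>_def)
    also have "\<dots> = c / 2" using hK by (subst mult.commute[of 2]) (simp only: divide_divide_eq_left[symmetric] times_divide_eq_left, simp)
    finally show "\<delta> * (2 + h * K) \<le> c / 2" .
  qed
  obtain W where "W \<in> P" and near: "\<And>x. x \<in> sphere 0 1 \<Longrightarrow> \<bar>W x - V x\<bar> \<le> \<delta>"
    using assms(2)[OF V(1) \<delta>(1)] by blast
  have W: "W \<in> convex_abs_homogeneous" using \<open>W \<in> P\<close> assms(1) by blast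
  have WV: "\<bar>W x - V x\<bar> \<le> \<delta> * norm x" for x
    by (rule abs_diff_le_from_sphere[OF V(1) W near])
  have WL: "W x \<le> (C + \<delta>) * norm x" for x
    using WV[of x] V(3)[of x] by (simp add: distrib_right)
  have Wdec: "W (x + h *\<^sub>R (A *v x)) \<le> W x - c / 2 * norm x" if A: "A \<in> M" for A x
  proof -
    have "h * norm (A *v x) \<le> h * (K * norm x)"
      using norm_matrix_vector_mult_le_bound[OF K(2)[OF A], of x] \<open>h > 0\<close> by (intro mult_left_mono) auto
    moreover have "norm (x + h *\<^sub>R (A *v x)) \<le> norm x + h * norm (A *v x)"
      using norm_triangle_ineq[of x "h *\<^sub>R (A *v x)"] \<open>h > 0\<close> by simp
    ultimately have "norm (x + h *\<^sub>R (A *v x)) \<le> norm x + h * (K * norm x)" by linarith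
    then have "\<delta> * norm (x + h *\<^sub>R (A *v x)) \<le> \<delta> * (norm x + h * (K * norm x))"
      using \<delta>(1) by (intro mult_left_mono) auto
    then have "W (x + h *\<^sub>R (A *v x)) \<le> W x - c * norm x + (\<delta> * (2 + h * K)) * norm x"
      using WV[of "x + h *\<^sub>R (A *v x)"] dec[OF A, of x] WV[of x] by (simp add: algebra_simps)
    also have "\<dots> \<le> W x - c * norm x + c / 2 * norm x"
      using \<delta>(3) by (intro add_left_mono mult_right_mono) auto
    finally show ?thesis by (simp add: algebra_simps)
  qed
  have "0 < W x" if "x \<noteq> 0" for x
  proof -
    have "\<delta> * norm x \<le> 1/2 * norm x" using \<delta>(2) by (intro mult_right_mono) auto
    then show ?thesis using WV[of x] V(2)[of x] that zero_less_norm_iff[of x] by linarith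
  qed
  moreover have "continuous_on UNIV W"
  \<comment> \<open>The absolute value supplies the nonnegativity demanded of a Lipschitz
    constant.\<close>
  proof (rule lipschitz_on_continuous_on[of "\<bar>C + \<delta>\<bar>"], rule lipschitz_onI)
    fix x y
    have "\<bar>W x - W y\<bar> \<le> (C + \<delta>) * norm (x - y)"
      by (rule convex_abs_homogeneous_diff_le[OF W WL])
    also have "\<dots> \<le> \<bar>C + \<delta>\<bar> * norm (x - y)" by (intro mult_right_mono) auto
    finally show "dist (W x) (W y) \<le> \<bar>C + \<delta>\<bar> * dist x y" by (simp add: dist_norm dist_real_def)
  qed simp
  moreover have "strict_antimono_on {0..} (\<lambda>t. W (x t))"
    if "A \<in> switching_laws M" "trajectory A x" "x 0 \<noteq> 0" for A x
    by (rule euler_decreasing_imp_strict_antimono[OF W WL \<open>h > 0\<close> _ Wdec K(2) that]) (use \<open>c > 0\<close> in auto)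
  ultimately have "common_lyapunov_function M W"
    using W by (simp add: common_lyapunov_function_def convex_abs_homogeneous_nonneg convex_abs_homogeneous_zero)
  then show "\<exists>V\<in>P. common_lyapunov_function M V" using \<open>W \<in> P\<close> by blast
qed

end
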